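(* There exists an absolute constant $c>0$ such that for all sufficiently large $n$, $$D_3(n)\ge c\,n^{1/21}.$$
   Context: A finite set of at least four planes in $\mathbb{R}^3$ is in general position if every three of the planes meet in a single point and no four of them have a common point. Any four planes of such a set determine a tetrahedron, whose vertices are the four intersection points of the three-element subfamilies. $D_3(n)$ denotes the largest integer $t$ such that every set of $n$ planes in general position in $\mathbb{R}^3$ contains a subset of $t$ planes for which all the tetrahedra determined by its four-element subsets have pairwise distinct volumes. *)

theory Defs
  imports "HOL-Analysis.Analysis"
begin

definition is_plane :: "(real^3) set \<Rightarrow> bool" where
  "is_plane H \<longleftrightarrow> affine H \<and> aff_dim H = 2"

definition general_position :: "(real^3) set set \<Rightarrow> bool" where
  "general_position P \<longleftrightarrow>
     finite P \<and> card P \<ge> 4 \<and> (\<forall>H\<in>P. is_plane H) \<and>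
     (\<forall>T. T \<subseteq> P \<and> card T = 3 \<longrightarrow> (\<exists>p. \<Inter>T = {p})) \<and>
     (\<forall>T. T \<subseteq> P \<and> card T = 4 \<longrightarrow> \<Inter>T = {})"

definition tetrahedron_vertices :: "(real^3) set set \<Rightarrow> (real^3) set" where
  "tetrahedron_vertices Q = {p. \<exists>T. T \<subseteq> Q \<and> card T = 3 \<and> \<Inter>T = {p}}"

definition tetrahedron :: "(real^3) set set \<Rightarrow> (real^3) set" where
  "tetrahedron Q = convex hull (tetrahedron_vertices Q)"

definition tetrahedron_volume :: "(real^3) set set \<Rightarrow> real" where
  "tetrahedron_volume Q = measure lborel (tetrahedron Q)"

definition distinct_volumes :: "(real^3) set set \<Rightarrow> bool" where
  "distinct_volumes S \<longleftrightarrow> inj_on tetrahedron_volume {Q. Q \<subseteq> S \<and> card Q = 4}"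

text \<open>
  For \<open>n < 4\<close> no set of \<open>n\<close> planes is in general position, so the maximum below does not
  exist and the value of \<open>D3 n\<close> is unspecified. For \<open>n \<ge> 4\<close> sets of \<open>n\<close> planes in general
  position exist, so the admissible \<open>t\<close> are bounded by \<open>n\<close>.
\<close>
definition D3 :: "nat \<Rightarrow> nat" where
  "D3 n = (GREATEST t. \<forall>P. general_position P \<and> card P = n \<longrightarrow>
             (\<exists>S. S \<subseteq> P \<and> card S = t \<and> distinct_volumes S))"

end

theory Submission
  imports Defs
begin

text \<open>
  In affine coordinates in which two planes \<open>A\<close>, \<open>B\<close> are \<open>x = 0\<close> and \<open>y = 0\<close>, planes \<open>z = c + p x + q y\<close> and
  \<open>z = d + a x + b y\<close> cut off together with \<open>A\<close> and \<open>B\<close> a tetrahedron of volume proportional to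
  \<open>\<bar>d - c\<bar>\<^sup>3 / (\<bar>a - p\<bar> \<bar>b - q\<bar>)\<close>. Prescribing this volume for three different \<open>(c, p, q)\<close>
  leaves at most \<open>48\<close> possibilities for \<open>(d, a, b)\<close>: otherwise two cubes \<open>(x - c)\<^sup>3\<close> and \<open>(x - c')\<^sup>3\<close>
  would have factorisations whose factors differ by constants, or three such cubes and a constant would be
  linearly dependent.

  So for every \<open>A\<close>, \<open>B\<close> and every function \<open>v\<close>, the pairs \<open>(C, D)\<close> whose tetrahedron has volume \<open>v C\<close>
  form a graph without a \<open>K(3, 49)\<close>, and there are \<open>O(n\<^bsup>5/3\<^esup>)\<close> of them. Consequently two given
  quadruples of indices receive equal volumes with probability \<open>O(n\<^bsup>-1/3\<^esup>)\<close> under a random choice of \<open>s\<close>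
  planes. There are at most \<open>s\<^sup>8\<close> pairs of quadruples, so for \<open>s\<close> a small multiple of \<open>n\<^bsup>1/21\<^esup>\<close> at most
  \<open>s / 2\<close> coincidences are expected, and deleting one plane for each of them leaves at least \<open>s / 2\<close> planes.
\<close>

section \<open>Solutions of the volume equations\<close>

text \<open>Degrees and orders at \<open>c\<close> both add up to \<open>n\<close> over the two
  factors, and an order never exceeds the degree. So order equals degree in \<open>X\<close>, which
  leaves only a constant cofactor.\<close>

lemma factor_of_linear_power:
  fixes X Y :: "real poly"
  assumes XY: "X * Y = smult k ([:-c, 1:] ^ n)" and k: "k \<noteq> 0"
  shows "X = smult (lead_coeff X) ([:-c, 1:] ^ degree X)" and "degree X + degree Y = n"
    and "X \<noteq> 0"
proof -
  have nz: "X * Y \<noteq> 0"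
    unfolding XY using k by simp
  then show X: "X \<noteq> 0" by auto
  have Y: "Y \<noteq> 0" using nz by auto
  have "degree (X * Y) = n"
    unfolding XY using k by (simp add: degree_linear_power)
  then show deg: "degree X + degree Y = n"
    using X Y by (simp add: degree_mult_eq)
  have "order c (X * Y) = n"
    unfolding XY using k by (simp add: order_smult order_power_n_n)
  then have "order c X + order c Y = n"
    using nz by (simp add: order_mult)
  moreover have "order c X \<le> degree X" "order c Y \<le> degree Y"
    using X Y by (auto intro: order_degree)
  ultimately have "order c X = degree X" using deg by linarith
  then obtain R where R: "X = [:-c, 1:] ^ degree X * R"
    by (metis order_1 dvdE)
  have Rnz: "R \<noteq> 0" using R X by auto
  have "degree X = degree X + degree R"
    using arg_cong[OF R, of degree] Rnz by (simp add: degree_mult_eq degree_linear_power)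
  then obtain r where r: "R = [:r:]"
    by (metis add_cancel_left_right degree_eq_zeroE)
  have "lead_coeff X = r"
    using arg_cong[OF R, of lead_coeff] r by (simp only: lead_coeff_mult lead_coeff_power) simp
  then show "X = smult (lead_coeff X) ([:-c, 1:] ^ degree X)"
    using R r by simp
qed

text \<open>Subtracting a constant keeps the derivative. As \<open>n\<close> is at least 2, the
  first form of the derivative vanishes at \<open>c\<close>, and the second one, where
  \<open>a'\<close> is nonzero, vanishes only at \<open>c'\<close>.\<close>

lemma translate_of_linear_power:
  fixes X :: "real poly"
  assumes X: "X = smult a ([:-c, 1:] ^ n)" and X': "X - [:P:] = smult a' ([:-c', 1:] ^ n)"
    and "2 \<le> n" "a' \<noteq> 0"
  shows "c = c'"
proof -
  obtain m where n: "n = Suc m" and m: "m \<noteq> 0" using \<open>2 \<le> n\<close> by (cases n) auto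
  have "pderiv X = pderiv (X - [:P:])" by (simp add: pderiv_diff pderiv_pCons)
  then have "poly (pderiv (smult a ([:-c, 1:] ^ n))) c = poly (pderiv (smult a' ([:-c', 1:] ^ n))) c"
    by (simp flip: X X')
  then have "a' * (real n * (c - c') ^ m) = 0"
    unfolding n pderiv_smult pderiv_power_Suc using m by (simp add: pderiv_pCons power_0_left)
  then show ?thesis using assms by auto
qed

text \<open>The degrees of \<open>X\<close> and \<open>Y\<close> add up to 3, so one of them is at
  least 2; comparing that factor with its translate identifies the two centres.\<close>

lemma not_both_cubes:
  fixes X Y :: "real poly"
  assumes E1: "X * Y = smult k ([:-c, 1:] ^ 3)" and k: "k \<noteq> 0"
    and E2: "(X - [:P:]) * (Y - [:Q:]) = smult k' ([:-c', 1:] ^ 3)" and k': "k' \<noteq> 0"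
  shows "c = c'"
proof -
  \<comment> \<open>Factors and shifts are generalised so that the claim also applies with
    \<open>X\<close> and \<open>Y\<close> exchanged.\<close>
  have *: "c = c'" if E1: "X * Y = smult k ([:-c, 1:] ^ 3)"
    and E2: "(X - [:P:]) * (Y - [:Q:]) = smult k' ([:-c', 1:] ^ 3)" and d: "2 \<le> degree X"
    for X Y :: "real poly" and P Q
  proof -
    have "degree [:P:] < degree X" using d by simp
    then have deg: "degree (X - [:P:]) = degree X"
      by (metis degree_add_eq_left diff_conv_add_uminus degree_minus)
    have "lead_coeff (X - [:P:]) \<noteq> 0"
      using factor_of_linear_power(3)[OF E2 k'] by (simp only: leading_coeff_neq_0 not_False_eq_True)
    then show ?thesis
      using translate_of_linear_power[OF factor_of_linear_power(1)[OF E1 k] _ d, of P _ c']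
        factor_of_linear_power(1)[OF E2 k'] deg by metis
  qed
  have "degree X + degree Y = 3" using factor_of_linear_power(2)[OF E1 k] .
  then consider "2 \<le> degree X" | "2 \<le> degree Y" by linarith
  then show ?thesis
  proof cases
    case 1 then show ?thesis using * E1 E2 by blast
  next
    case 2
    have "Y * X = smult k ([:-c, 1:] ^ 3)" "(Y - [:Q:]) * (X - [:P:]) = smult k' ([:-c', 1:] ^ 3)"
      using E1 E2 by (simp_all only: mult.commute)
    then show ?thesis using * 2 by blast
  qed
qed

text \<open>The coefficients of degrees 1 to 3 do not involve \<open>e\<close> and give a
  Vandermonde system for \<open>m1\<close>, \<open>m2\<close>, \<open>m3\<close>.\<close>

lemma cubes_linear_independent:
  fixes m1 m2 m3 :: real
  assumes c: "c1 \<noteq> c2" "c1 \<noteq> c3"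
    and z: "smult m1 ([:-c1, 1:] ^ 3) + smult m2 ([:-c2, 1:] ^ 3) + smult m3 ([:-c3, 1:] ^ 3) + [:e:] = 0"
  shows "m1 = 0"
proof -
  have "coeff (smult m1 ([:-c1, 1:] ^ 3) + smult m2 ([:-c2, 1:] ^ 3) + smult m3 ([:-c3, 1:] ^ 3) + [:e:]) i = 0" for i
    unfolding z by simp
  from this[of 1] this[of 2] this[of 3]
  have "m1 * c1\<^sup>2 + m2 * c2\<^sup>2 + m3 * c3\<^sup>2 = 0" "m1 * c1 + m2 * c2 + m3 * c3 = 0" "m1 + m2 + m3 = 0"
    by (simp_all add: power3_eq_cube power2_eq_square numeral_eq_Suc algebra_simps)
  \<comment> \<open>Weighting the three equations by the coefficients of
    \<open>(x - c2) * (x - c3)\<close> eliminates \<open>m2\<close> and \<open>m3\<close>.\<close>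
  then have "m1 * ((c1 - c2) * (c1 - c3)) = 0" by algebra
  then show ?thesis using c by simp
qed

section \<open>Counting the solutions of three volume equations\<close>

lemma subset_tripleI:
  assumes "\<And>a b c. (a, b, c) \<in> S \<Longrightarrow> (a, b, c) \<in> T"
  shows "S \<subseteq> T"
  using assms by auto

lemma card_le_of_fibres:
  assumes "finite D" "card D \<le> k" "\<And>d. d \<in> D \<Longrightarrow> finite (F d) \<and> card (F d) \<le> l"
    and "S \<subseteq> Sigma D F"
  shows "finite S \<and> card S \<le> k * l"
proof -
  have "finite (Sigma D F)" using assms by auto
  moreover have "card (Sigma D F) = (\<Sum>d\<in>D. card (F d))" using assms by simp
  moreover have "\<dots> \<le> card D * l" using sum_bounded_above[of D "\<lambda>d. card (F d)" l] assms by auto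
  moreover have "\<dots> \<le> k * l" using assms by simp
  ultimately show ?thesis using assms(4) by (metis card_mono finite_subset le_trans)
qed

lemma card_poly_roots_le:
  fixes p :: "real poly"
  assumes "p \<noteq> 0" "degree p \<le> k"
  shows "finite {x. poly p x = 0} \<and> card {x. poly p x = 0} \<le> k"
  using card_poly_roots_bound[OF assms(1)] poly_roots_finite[OF assms(1)] assms(2) by simp

text \<open>Differences of the equations are linear in \<open>a\<close> and \<open>b\<close>, with determinant \<open>t\<close>. If \<open>t \<noteq> 0\<close>, then \<open>d\<close> is a
  root of a polynomial of degree at most 6 and determines \<open>a\<close> and \<open>b\<close>; if \<open>t = 0\<close>, consistency restricts
  \<open>d\<close> to the roots of a cubic, and each such \<open>d\<close> leaves a quadratic equation for \<open>a\<close>.\<close>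

lemma three_equations_centred:
  fixes c1 c2 c3 w1 w2 w3 P2 P3 Q2 Q3 :: real
  assumes c: "c1 \<noteq> c2" "c1 \<noteq> c3" "c2 \<noteq> c3" and w: "w1 \<noteq> 0" "w2 \<noteq> 0" "w3 \<noteq> 0"
    and P: "P2 \<noteq> 0" "P3 \<noteq> 0" "P2 \<noteq> P3" and Q: "Q2 \<noteq> 0" "Q3 \<noteq> 0"
  defines "S \<equiv> {(d, a, b). a * b = w1 * (d - c1) ^ 3 \<and> (a - P2) * (b - Q2) = w2 * (d - c2) ^ 3 \<and>
                    (a - P3) * (b - Q3) = w3 * (d - c3) ^ 3}"
  shows "finite S \<and> card S \<le> 6"
proof -
  define F1 where "F1 = smult w1 ([:-c1, 1:] ^ 3)"
  define F2 where "F2 = smult w2 ([:-c2, 1:] ^ 3)"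
  define F3 where "F3 = smult w3 ([:-c3, 1:] ^ 3)"
  have pF: "poly F1 d = w1 * (d - c1) ^ 3" "poly F2 d = w2 * (d - c2) ^ 3" "poly F3 d = w3 * (d - c3) ^ 3" for d
    by (simp_all add: F1_def F2_def F3_def)
  have dF: "degree F1 \<le> 3" "degree F2 \<le> 3" "degree F3 \<le> 3"
    by (simp_all add: F1_def F2_def F3_def degree_linear_power)
  \<comment> \<open>Expanding the products and subtracting cancels \<open>a * b\<close>: on
    solutions \<open>U\<close> is \<open>a * Q2 + b * P2\<close> and \<open>V\<close> is
    \<open>a * Q3 + b * P3\<close>.\<close>
  define U where "U = F1 - F2 + [:P2 * Q2:]"
  define V where "V = F1 - F3 + [:P3 * Q3:]"
  \<comment> \<open>\<open>X\<close> and \<open>Y\<close> are the numerators of Cramer's rule for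
    \<open>a\<close> and \<open>b\<close>.\<close>
  define X where "X = smult P3 U - smult P2 V"
  define Y where "Y = smult Q2 V - smult Q3 U"
  define t where "t = Q2 * P3 - Q3 * P2"
  have dX: "degree X \<le> 3" and dY: "degree Y \<le> 3"
    unfolding X_def Y_def U_def V_def using dF
    by (auto intro!: degree_diff_le degree_add_le order.trans[OF degree_smult_le])
  have UV: "poly U d = a * Q2 + b * P2" "poly V d = a * Q3 + b * P3" if "(d, a, b) \<in> S" for d a b
    using that by (auto simp: S_def U_def V_def pF algebra_simps)
  have tX: "t * a = poly X d" and tY: "t * b = poly Y d" if "(d, a, b) \<in> S" for d a b
    using UV[OF that] by (simp_all add: X_def Y_def t_def algebra_simps)
  show ?thesis
  proof (cases "t = 0")
    case False
    \<comment> \<open>On solutions \<open>X * Y\<close> is \<open>t\<^sup>2 * a * b\<close>, so the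
      first equation makes \<open>R\<close> vanish.\<close>
    define R where "R = X * Y - smult (t\<^sup>2) F1"
    have dR: "degree R \<le> 6"
      unfolding R_def using dX dY dF degree_mult_le[of X Y]
      by (intro degree_diff_le order.trans[OF degree_smult_le]) auto
    have nzR: "R \<noteq> 0"
    proof
      assume "R = 0"
      then have E1: "X * Y = smult (t\<^sup>2) F1" by (simp add: R_def)
      have "(X - [:t * P2:]) * (Y - [:t * Q2:]) = smult (t\<^sup>2) F2"
      proof (rule poly_ext)
        fix d
        have "poly X d * poly Y d = t\<^sup>2 * poly F1 d"
          using arg_cong[OF E1, of "\<lambda>p. poly p d"] by simp
        \<comment> \<open>This is \<open>Q2 * X + P2 * Y = t * U\<close>, an identity in
          \<open>d\<close>. It turns \<open>X * Y\<close> being a cube into the translated product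
          being a cube as well.\<close>
        moreover have "Q2 * poly X d + P2 * poly Y d = t * (poly F1 d - poly F2 d + P2 * Q2)"
          by (simp add: X_def Y_def U_def V_def t_def algebra_simps)
        ultimately have "(poly X d - t * P2) * (poly Y d - t * Q2) = t\<^sup>2 * poly F2 d"
          by algebra
        then show "poly ((X - [:t * P2:]) * (Y - [:t * Q2:])) d = poly (smult (t\<^sup>2) F2) d"
          by simp
      qed
      then have "(X - [:t * P2:]) * (Y - [:t * Q2:]) = smult (t\<^sup>2 * w2) ([:-c2, 1:] ^ 3)"
        by (simp add: F2_def)
      moreover have "X * Y = smult (t\<^sup>2 * w1) ([:-c1, 1:] ^ 3)"
        using E1 by (simp add: F1_def)
      ultimately show False
        using not_both_cubes[of X Y "t\<^sup>2 * w1" c1 "t * P2" "t * Q2" "t\<^sup>2 * w2" c2] False w c by simp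
    qed
    have "S \<subseteq> Sigma {d. poly R d = 0} (\<lambda>d. {(poly X d / t, poly Y d / t)})"
    proof (rule subset_tripleI, intro SigmaI)
      fix d a b assume s: "(d, a, b) \<in> S"
      have "poly R d = (t * a) * (t * b) - t\<^sup>2 * (a * b)"
        using s by (simp add: R_def tX tY S_def pF)
      then show "d \<in> {d. poly R d = 0}" by (simp add: power2_eq_square)
      show "(a, b) \<in> {(poly X d / t, poly Y d / t)}"
        using False by (simp flip: tX[OF s] tY[OF s])
    qed
    then show ?thesis
      using card_le_of_fibres[of "{d. poly R d = 0}" 6 "\<lambda>d. {(poly X d / t, poly Y d / t)}" 1 S]
        card_poly_roots_le[OF nzR dR] by simp
  next
    case True
    \<comment> \<open>\<open>X\<close> combines three cubes with different centres and a constant;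
      the first cube has the nonzero coefficient \<open>(P3 - P2) * w1\<close>.\<close>
    have nzX: "X \<noteq> 0"
    proof
      assume "X = 0"
      moreover have "X = smult ((P3 - P2) * w1) ([:-c1, 1:] ^ 3) + smult (- P3 * w2) ([:-c2, 1:] ^ 3)
          + smult (P2 * w3) ([:-c3, 1:] ^ 3) + [:P3 * P2 * Q2 - P2 * P3 * Q3:]"
        unfolding X_def U_def V_def F1_def F2_def F3_def
        by (simp add: smult_add_right smult_diff_right smult_diff_left algebra_simps)
      ultimately show False
        using cubes_linear_independent[OF c(1,2)] P w by (metis mult_eq_0_iff eq_iff_diff_eq_0)
    qed
    \<comment> \<open>Eliminating \<open>b\<close> from \<open>a * b = F1\<close> and
      \<open>a * Q2 + b * P2 = U\<close> gives this quadratic in \<open>a\<close>, with leading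
      coefficient \<open>- Q2\<close>. Three values of \<open>d\<close> times two of
      \<open>a\<close> give 6.\<close>
    define G where "G d = [:- poly F1 d * P2, poly U d, - Q2:]" for d
    have G: "G d \<noteq> 0" "degree (G d) \<le> 2" for d using Q by (simp_all add: G_def)
    define H where "H d = (\<lambda>a. (a, (poly U d - a * Q2) / P2)) ` {a. poly (G d) a = 0}" for d
    have H: "finite (H d) \<and> card (H d) \<le> 2" for d
      unfolding H_def using card_poly_roots_le[OF G] card_image_le
      by (meson finite_imageI le_trans)
    have "S \<subseteq> Sigma {d. poly X d = 0} H"
    proof (rule subset_tripleI, intro SigmaI)
      fix d a b assume s: "(d, a, b) \<in> S"
      show "d \<in> {d. poly X d = 0}" using tX[OF s] True by simp
      have "b = (poly U d - a * Q2) / P2" using UV[OF s] P by simp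
      moreover have "poly F1 d = a * b" using s by (simp add: S_def pF)
      then have "poly (G d) a = 0" using UV(1)[OF s] by (simp add: G_def algebra_simps)
      ultimately show "(a, b) \<in> H d" by (auto simp: H_def)
    qed
    then show ?thesis
      using card_le_of_fibres[of "{d. poly X d = 0}" 3 H 2 S] card_poly_roots_le[OF nzX dX] H by simp
  qed
qed
text \<open>Translating \<open>a\<close> by \<open>p1\<close> and \<open>b\<close> by
  \<open>q1\<close> reduces this to the centred case.\<close>

lemma three_equations:
  fixes c1 c2 c3 w1 w2 w3 p1 p2 p3 q1 q2 q3 :: real
  assumes c: "c1 \<noteq> c2" "c1 \<noteq> c3" "c2 \<noteq> c3" and w: "w1 \<noteq> 0" "w2 \<noteq> 0" "w3 \<noteq> 0"
    and p: "p1 \<noteq> p2" "p1 \<noteq> p3" "p2 \<noteq> p3" and q: "q1 \<noteq> q2" "q1 \<noteq> q3"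
  defines "S \<equiv> {(d, a, b). (a - p1) * (b - q1) = w1 * (d - c1) ^ 3 \<and>
                    (a - p2) * (b - q2) = w2 * (d - c2) ^ 3 \<and>
                    (a - p3) * (b - q3) = w3 * (d - c3) ^ 3}"
  shows "finite S \<and> card S \<le> 6"
proof -
  define T where "T = {(d, a, b). a * b = w1 * (d - c1) ^ 3 \<and>
      (a - (p2 - p1)) * (b - (q2 - q1)) = w2 * (d - c2) ^ 3 \<and>
      (a - (p3 - p1)) * (b - (q3 - q1)) = w3 * (d - c3) ^ 3}"
  have T: "finite T \<and> card T \<le> 6"
    unfolding T_def by (rule three_equations_centred) (use assms in auto)
  have "S \<subseteq> (\<lambda>(d, a, b). (d, a + p1, b + q1)) ` T"
  proof (rule subset_tripleI)
    fix d a b assume s: "(d, a, b) \<in> S"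
    have "(d, a - p1, b - q1) \<in> T"
      using s by (simp add: S_def T_def)
    then show "(d, a, b) \<in> (\<lambda>(d, a, b). (d, a + p1, b + q1)) ` T"
      by (rule rev_image_eqI) simp
  qed
  then show ?thesis
    using T by (meson card_image_le card_mono finite_imageI finite_subset le_trans)
qed

text \<open>Each absolute value equation holds up to a sign that can be absorbed into its weight; 8
  sign patterns with 6 solutions each give 48.\<close>

lemma three_abs_equations:
  fixes c1 c2 c3 w1 w2 w3 p1 p2 p3 q1 q2 q3 :: real
  assumes c: "c1 \<noteq> c2" "c1 \<noteq> c3" "c2 \<noteq> c3" and w: "w1 \<noteq> 0" "w2 \<noteq> 0" "w3 \<noteq> 0"
    and p: "p1 \<noteq> p2" "p1 \<noteq> p3" "p2 \<noteq> p3" and q: "q1 \<noteq> q2" "q1 \<noteq> q3"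
  defines "S \<equiv> {(d, a, b). \<bar>a - p1\<bar> * \<bar>b - q1\<bar> = w1 * \<bar>d - c1\<bar> ^ 3 \<and>
                    \<bar>a - p2\<bar> * \<bar>b - q2\<bar> = w2 * \<bar>d - c2\<bar> ^ 3 \<and>
                    \<bar>a - p3\<bar> * \<bar>b - q3\<bar> = w3 * \<bar>d - c3\<bar> ^ 3}"
  shows "finite S \<and> card S \<le> 48"
proof -
  define T where "T = (\<lambda>(s1, s2, s3). {(d, a, b). (a - p1) * (b - q1) = (s1 * w1) * (d - c1) ^ 3 \<and>
      (a - p2) * (b - q2) = (s2 * w2) * (d - c2) ^ 3 \<and> (a - p3) * (b - q3) = (s3 * w3) * (d - c3) ^ 3})"
  define I :: "(real \<times> real \<times> real) set" where "I = {1, -1} \<times> {1, -1} \<times> {1, -1}"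
  have I: "finite I" "card I = 8" by (simp_all add: I_def)
  have T: "finite (T s) \<and> card (T s) \<le> 6" if "s \<in> I" for s
  proof -
    obtain s1 s2 s3 where s: "s = (s1, s2, s3)" by (cases s)
    show ?thesis
      unfolding T_def s prod.case by (rule three_equations) (use assms that s in \<open>auto simp: I_def\<close>)
  qed
  have sgn: "\<exists>s\<in>{1, -1}. x * y = (s * w) * z ^ 3" if "\<bar>x\<bar> * \<bar>y\<bar> = w * \<bar>z\<bar> ^ 3" for x y z w :: real
  proof -
    have "\<bar>x * y\<bar> = w * \<bar>z ^ 3\<bar>"
      using that by (simp only: abs_mult power_abs)
    then show ?thesis by (auto simp: abs_if split: if_splits)
  qed
  have "S \<subseteq> (\<Union>s\<in>I. T s)"
  proof (rule subset_tripleI)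
    fix d a b assume "(d, a, b) \<in> S"
    then have "\<bar>a - p1\<bar> * \<bar>b - q1\<bar> = w1 * \<bar>d - c1\<bar> ^ 3"
      "\<bar>a - p2\<bar> * \<bar>b - q2\<bar> = w2 * \<bar>d - c2\<bar> ^ 3" "\<bar>a - p3\<bar> * \<bar>b - q3\<bar> = w3 * \<bar>d - c3\<bar> ^ 3"
      by (simp_all add: S_def)
    then obtain s1 s2 s3 where "s1 \<in> {1, -1}" "s2 \<in> {1, -1}" "s3 \<in> {1, -1}"
      "(a - p1) * (b - q1) = (s1 * w1) * (d - c1) ^ 3"
      "(a - p2) * (b - q2) = (s2 * w2) * (d - c2) ^ 3"
      "(a - p3) * (b - q3) = (s3 * w3) * (d - c3) ^ 3"
      using sgn by meson
    then have "(s1, s2, s3) \<in> I" "(d, a, b) \<in> T (s1, s2, s3)"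
      unfolding I_def T_def prod.case by (blast, blast)
    then show "(d, a, b) \<in> (\<Union>s\<in>I. T s)" by blast
  qed
  moreover have "finite (\<Union>s\<in>I. T s)" using I T by blast
  moreover have "card (\<Union>s\<in>I. T s) \<le> 48"
    using card_UN_le[OF I(1), of T] sum_bounded_above[of I "\<lambda>s. card (T s)" 6] T I by auto
  ultimately show ?thesis by (metis card_mono finite_subset le_trans)
qed

section \<open>Volumes in adapted coordinates\<close>

text \<open>The standard simplex has volume \<open>1 / 3!\<close>, and \<open>h\<close> scales
  volumes by the modulus of its determinant. Hulls of finite sets are compact, so
  \<open>lborel\<close> and \<open>lebesgue\<close> agree on them.\<close>

lemma measure_simplex_affine_image:
  fixes h :: "real^3 \<Rightarrow> real^3"
  assumes h: "linear h"
  shows "measure lborel (convex hull ((\<lambda>y. r + h y) ` insert 0 Basis)) = \<bar>det (matrix h)\<bar> / 6"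
proof -
  let ?S = "insert 0 Basis :: (real^3) set"
  have cmp: "compact (convex hull X)" if "finite X" for X :: "(real^3) set"
    using that by (simp add: compact_convex_hull finite_imp_compact)
  have lb: "measure lborel (convex hull X) = measure lebesgue (convex hull X)" if "finite X" for X :: "(real^3) set"
    using cmp[OF that] by (simp add: measure_completion compact_imp_closed borel_closed)
  have "convex hull ((\<lambda>y. r + h y) ` ?S) = (+) r ` h ` (convex hull ?S)"
    using convex_hull_translation[of r "h ` ?S"] convex_hull_linear_image[OF h, of ?S]
    by (simp add: image_image)
  then have "measure lborel (convex hull ((\<lambda>y. r + h y) ` ?S)) = measure lebesgue ((+) r ` h ` (convex hull ?S))"
    using lb[of "(\<lambda>y. r + h y) ` ?S"] by simp
  also have "\<dots> = \<bar>det (matrix h)\<bar> * measure lebesgue (convex hull ?S)"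
    using cmp[of ?S] by (simp add: measure_translation measure_linear_image[OF h] lmeasurable_compact)
  also have "measure lebesgue (convex hull ?S) = 1 / 6"
    using lb[of ?S] content_std_simplex[where 'a = "real^3"] by (simp add: fact_numeral)
  finally show ?thesis by (simp only: times_divide_eq_right mult_1_right)
qed

text \<open>A three-element subfamily omits exactly one of the four planes.\<close>

lemma tetrahedron_vertices_eq:
  assumes "card {A, B, C, D} = 4"
    and "A \<inter> B \<inter> C = {r1}" "A \<inter> B \<inter> D = {r2}" "A \<inter> C \<inter> D = {r3}" "B \<inter> C \<inter> D = {r4}"
  shows "tetrahedron_vertices {A, B, C, D} = {r1, r2, r3, r4}"
proof -
  have dist: "A \<noteq> B" "A \<noteq> C" "A \<noteq> D" "B \<noteq> C" "B \<noteq> D" "C \<noteq> D"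
    using assms(1) by (auto simp: card_insert_if split: if_splits)
  have *: "T \<subseteq> {A, B, C, D} \<and> card T = 3 \<longleftrightarrow> T \<in> {{A, B, C}, {A, B, D}, {A, C, D}, {B, C, D}}" for T
  proof
    assume T: "T \<subseteq> {A, B, C, D} \<and> card T = 3"
    then have "card ({A, B, C, D} - T) = 1"
      using assms(1) by (subst card_Diff_subset) (auto intro: finite_subset)
    then obtain X where X: "{A, B, C, D} - T = {X}" by (rule card_1_singletonE)
    have TX: "T = {A, B, C, D} - {X}" unfolding X[symmetric] using T by (simp add: double_diff)
    have XQ: "X \<in> {A, B, C, D}" using X by (metis DiffD1 singletonI)
    have "X = A \<Longrightarrow> T = {B, C, D}" "X = B \<Longrightarrow> T = {A, C, D}" "X = C \<Longrightarrow> T = {A, B, D}" "X = D \<Longrightarrow> T = {A, B, C}"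
      using dist by (simp_all add: TX insert_Diff_if)
    with XQ show "T \<in> {{A, B, C}, {A, B, D}, {A, C, D}, {B, C, D}}" by (metis insert_iff empty_iff)
  next
    assume "T \<in> {{A, B, C}, {A, B, D}, {A, C, D}, {B, C, D}}"
    then show "T \<subseteq> {A, B, C, D} \<and> card T = 3"
      using dist by (elim insertE emptyE) simp_all
  qed
  have "tetrahedron_vertices {A, B, C, D} = {x. \<exists>T\<in>{{A, B, C}, {A, B, D}, {A, C, D}, {B, C, D}}. \<Inter>T = {x}}"
    unfolding tetrahedron_vertices_def conj_assoc[symmetric] * by (simp only: Bex_def)
  also have "\<dots> = {r1, r2, r3, r4}"
  proof -
    have I: "\<Inter>{A, B, C} = {r1}" "\<Inter>{A, B, D} = {r2}" "\<Inter>{A, C, D} = {r3}" "\<Inter>{B, C, D} = {r4}"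
      using assms(2-5) by (simp_all add: Int_assoc)
    show ?thesis unfolding bex_simps I by blast
  qed
  finally show ?thesis .
qed

lemma is_plane_hyperplane:
  assumes "is_plane H"
  obtains n h where "H = {x. n \<bullet> x = h}"
proof -
  have "aff_dim H = int (DIM(real^3) - 1)" and aff: "affine hull H = H"
    using assms by (simp_all add: is_plane_def affine_hull_eq)
  from aff_dim_eq_hyperplane[THEN iffD1, OF this(1)] obtain n h where "affine hull H = {x. n \<bullet> x = h}"
    by blast
  then have "H = {x. n \<bullet> x = h}" unfolding aff .
  then show ?thesis by (rule that)
qed

section \<open>Affine charts in which two planes become coordinate planes\<close>

locale chart =
  fixes g :: "real^3 \<Rightarrow> real^3" and p :: "real^3" and A B :: "(real^3) set"
  assumes lin: "linear g" and bij: "bij g"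
    and A_iff: "p + g y \<in> A \<longleftrightarrow> y $ 1 = 0" and B_iff: "p + g y \<in> B \<longleftrightarrow> y $ 2 = 0"
begin

text \<open>The third axis of the chart is the line where \<open>A\<close> and \<open>B\<close>
  meet. The triple consists of the height at which \<open>H\<close> crosses it and the slopes of
  \<open>H\<close> along the first and second axes.\<close>

definition is_graph :: "(real^3) set \<Rightarrow> real \<times> real \<times> real \<Rightarrow> bool" where
  "is_graph H = (\<lambda>(c, a, b). \<forall>y. p + g y \<in> H \<longleftrightarrow> y $ 3 = c + a * y $ 1 + b * y $ 2)"

lemma coordinates: obtains y where "x = p + g y"
proof -
  obtain y where "g y = x - p" using bij_is_surj[OF bij] by (metis surjD)
  then have "x = p + g y" by simp
  then show thesis by (rule that)
qed

lemma coordinates_inj: "p + g y = p + g z \<longleftrightarrow> y = z"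
proof
  assume "p + g y = p + g z"
  then have "g y = g z" by (rule add_left_imp_eq)
  then show "y = z" by (rule injD[OF bij_is_inj[OF bij]])
qed simp

lemma singleton_iff_coordinates: "X = {p + g z} \<longleftrightarrow> (\<forall>y. p + g y \<in> X \<longleftrightarrow> y = z)"
proof
  assume *: "\<forall>y. p + g y \<in> X \<longleftrightarrow> y = z"
  show "X = {p + g z}"
  proof (rule set_eqI)
    fix x obtain y where "x = p + g y" using coordinates by blast
    then show "x \<in> X \<longleftrightarrow> x \<in> {p + g z}" using * coordinates_inj by simp
  qed
next
  assume "X = {p + g z}"
  then show "\<forall>y. p + g y \<in> X \<longleftrightarrow> y = z"
    by (simp only: singleton_iff coordinates_inj simp_thms)
qed

text \<open>If the normal of \<open>H\<close> had no component along the third axis, moving along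
  that axis would stay in \<open>A\<close>, \<open>B\<close> and \<open>H\<close>, contradicting the
  single common point. So the equation of \<open>H\<close> can be solved for the third
  coordinate.\<close>

lemma is_graph_exists:
  assumes "is_plane H" and q: "A \<inter> B \<inter> H = {q}"
  obtains s where "is_graph H s"
proof -
  obtain n h where H: "H = {x. n \<bullet> x = h}" using is_plane_hyperplane assms by blast
  define N where "N i = n \<bullet> g (axis i 1)" for i
  have N: "n \<bullet> (p + g y) = n \<bullet> p + N 1 * y $ 1 + N 2 * y $ 2 + N 3 * y $ 3" for y
  proof -
    have "y = y $ 1 *\<^sub>R axis 1 1 + y $ 2 *\<^sub>R axis 2 1 + y $ 3 *\<^sub>R axis 3 1"
      by (simp add: vec_eq_iff forall_3 axis_def)
    then have "g y = g (y $ 1 *\<^sub>R axis 1 1 + y $ 2 *\<^sub>R axis 2 1 + y $ 3 *\<^sub>R axis 3 1)"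
      by (rule arg_cong)
    then have "g y = y $ 1 *\<^sub>R g (axis 1 1) + y $ 2 *\<^sub>R g (axis 2 1) + y $ 3 *\<^sub>R g (axis 3 1)"
      by (simp only: linear_add[OF lin] linear_scale[OF lin])
    then show ?thesis by (simp add: inner_add_right N_def)
  qed
  obtain z where z: "q = p + g z" using coordinates by blast
  have u: "(y $ 1 = 0 \<and> y $ 2 = 0 \<and> n \<bullet> (p + g y) = h) \<longleftrightarrow> y = z" for y
  proof -
    have "p + g y \<in> A \<inter> B \<inter> H \<longleftrightarrow> y = z"
      using q[unfolded z singleton_iff_coordinates] by blast
    then show ?thesis by (simp add: A_iff B_iff H)
  qed
  have "N 3 \<noteq> 0"
  proof
    assume "N 3 = 0"
    moreover have "(z + axis 3 1) $ 1 = z $ 1" "(z + axis 3 1) $ 2 = z $ 2"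
      by (simp_all add: axis_def)
    ultimately have "z + axis 3 1 = z"
      using u[of z] u[of "z + axis 3 1"] unfolding N by auto
    then show False by (simp add: axis_eq_0_iff)
  qed
  then have "P + N 1 * x + N 2 * y + N 3 * z = h \<longleftrightarrow> z = (h - P) / N 3 + - N 1 / N 3 * x + - N 2 / N 3 * y" for P x y z
  proof -
    have "(h - P) / N 3 + - N 1 / N 3 * x + - N 2 / N 3 * y = (h - P - N 1 * x - N 2 * y) / N 3"
      by (simp add: diff_divide_distrib)
    then show ?thesis using \<open>N 3 \<noteq> 0\<close> by (auto simp: eq_divide_eq algebra_simps)
  qed
  then have "is_graph H ((h - n \<bullet> p) / N 3, - N 1 / N 3, - N 2 / N 3)"
    unfolding is_graph_def H prod.case mem_Collect_eq N by blast
  then show ?thesis using that by blast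
qed

lemma is_graph_unique:
  assumes "is_graph H s" "is_graph H' s"
  shows "H = H'"
proof (rule set_eqI)
  fix x obtain y where "x = p + g y" using coordinates by blast
  then show "x \<in> H \<longleftrightarrow> x \<in> H'" using assms by (cases s) (auto simp: is_graph_def)
qed

text \<open>Equal slopes would make the traces of \<open>C\<close> and \<open>D\<close> on
  \<open>A\<close> (or on \<open>B\<close>) parallel lines; having a common point they would
  coincide and share more than one point.\<close>

lemma two_graphs:
  assumes C: "is_graph C (c, a, b)" and D: "is_graph D (d, a', b')"
    and sing: "\<exists>x. A \<inter> C \<inter> D = {x}" "\<exists>x. B \<inter> C \<inter> D = {x}"
  shows "b \<noteq> b'" and "a \<noteq> a'"
proof -
  have pt: "p + g (vector [x, y, z]) \<in> C \<longleftrightarrow> z = c + a * x + b * y"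
    "p + g (vector [x, y, z]) \<in> D \<longleftrightarrow> z = d + a' * x + b' * y" for x y z
    using C D by (auto simp: is_graph_def)
  show "b \<noteq> b'"
  proof
    assume b: "b = b'"
    obtain z where z: "A \<inter> C \<inter> D = {p + g z}" using sing(1) coordinates by metis
    then have "p + g z \<in> A" "p + g z \<in> C" "p + g z \<in> D" by blast+
    then have *: "z $ 1 = 0" "c = d"
      using C D b by (auto simp: is_graph_def A_iff)
    have "vector [0, y, c + b * y] = z" for y
      using z[unfolded singleton_iff_coordinates] * pt b by (metis A_iff Int_iff vector_3(1) mult_zero_right add.right_neutral)
    from this[of 0] this[of 1] show False by (metis vector_3(2) zero_neq_one)
  qed
  show "a \<noteq> a'"
  proof
    assume a: "a = a'"
    obtain z where z: "B \<inter> C \<inter> D = {p + g z}" using sing(2) coordinates by metis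
    then have "p + g z \<in> B" "p + g z \<in> C" "p + g z \<in> D" by blast+
    then have *: "z $ 2 = 0" "c = d"
      using C D a by (auto simp: is_graph_def B_iff)
    have "vector [x, 0, c + a * x] = z" for x
      using z[unfolded singleton_iff_coordinates] * pt a by (metis B_iff Int_iff vector_3(2) mult_zero_right add.right_neutral)
    from this[of 0] this[of 1] show False by (metis vector_3(1) zero_neq_one)
  qed
qed

text \<open>Equal heights would give all four planes a common point on the third axis.\<close>

lemma two_graphs_height:
  assumes "is_graph C (c, a, b)" "is_graph D (d, a', b')" "A \<inter> B \<inter> C \<inter> D = {}"
  shows "c \<noteq> d"
proof
  assume "c = d"
  then have "p + g (vector [0, 0, c]) \<in> A \<inter> B \<inter> C \<inter> D"
    using assms(1,2) by (simp add: is_graph_def A_iff B_iff)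
  then show False unfolding assms(3) by simp
qed

text \<open>Two vertices lie on the third axis at heights \<open>c\<close> and \<open>d\<close>, the
  other two in the coordinate planes. The edges at the first vertex form a triangular matrix, so the
  volume is a product of three coordinates.\<close>

lemma tetrahedron_volume_eq:
  assumes C: "is_graph C (c, a, b)" and D: "is_graph D (d, a', b')"
    and card: "card {A, B, C, D} = 4" and ne: "a \<noteq> a'" "b \<noteq> b'"
  shows "tetrahedron_volume {A, B, C, D} = \<bar>det (matrix g)\<bar> / 6 * \<bar>d - c\<bar> ^ 3 / (\<bar>a' - a\<bar> * \<bar>b' - b\<bar>)"
proof -
  \<comment> \<open>\<open>x\<close> and \<open>y\<close> locate where the traces of
    \<open>C\<close> and \<open>D\<close> on \<open>B\<close> and on \<open>A\<close> cross.\<close>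
  define x where "x = (d - c) / (a - a')"
  define y where "y = (d - c) / (b - b')"
  have xy: "c + a * x = d + a' * x" "c + b * y = d + b' * y"
    using ne by (simp_all add: x_def y_def field_simps)
  have uniq: "c + a * x' = d + a' * x' \<Longrightarrow> x' = x" "c + b * y' = d + b' * y' \<Longrightarrow> y' = y" for x' y'
    using ne by (simp_all add: x_def y_def field_simps)
  note C' = C[unfolded is_graph_def prod.case, rule_format] and D' = D[unfolded is_graph_def prod.case, rule_format]
  have "A \<inter> B \<inter> C = {p + g (vector [0, 0, c])}" "A \<inter> B \<inter> D = {p + g (vector [0, 0, d])}"
    by (auto simp: singleton_iff_coordinates C' D' A_iff B_iff vec_eq_iff forall_3)
  moreover have "A \<inter> C \<inter> D = {p + g (vector [0, y, c + b * y])}"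
    unfolding singleton_iff_coordinates
  proof
    fix v
    have "p + g v \<in> A \<inter> C \<inter> D \<longleftrightarrow> v $ 1 = 0 \<and> v $ 3 = c + b * v $ 2 \<and> v $ 3 = d + b' * v $ 2"
      by (auto simp: A_iff C' D')
    also have "\<dots> \<longleftrightarrow> v $ 1 = 0 \<and> v $ 2 = y \<and> v $ 3 = c + b * y"
      using xy(2) uniq(2) by metis
    also have "\<dots> \<longleftrightarrow> v = vector [0, y, c + b * y]"
      by (auto simp: vec_eq_iff forall_3)
    finally show "p + g v \<in> A \<inter> C \<inter> D \<longleftrightarrow> v = vector [0, y, c + b * y]" .
  qed
  moreover have "B \<inter> C \<inter> D = {p + g (vector [x, 0, c + a * x])}"
    unfolding singleton_iff_coordinates
  proof
    fix v
    have "p + g v \<in> B \<inter> C \<inter> D \<longleftrightarrow> v $ 2 = 0 \<and> v $ 3 = c + a * v $ 1 \<and> v $ 3 = d + a' * v $ 1"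
      by (auto simp: B_iff C' D')
    also have "\<dots> \<longleftrightarrow> v $ 2 = 0 \<and> v $ 1 = x \<and> v $ 3 = c + a * x"
      using xy(1) uniq(1) by metis
    also have "\<dots> \<longleftrightarrow> v = vector [x, 0, c + a * x]"
      by (auto simp: vec_eq_iff forall_3)
    finally show "p + g v \<in> B \<inter> C \<inter> D \<longleftrightarrow> v = vector [x, 0, c + a * x]" .
  qed
  ultimately have vert: "tetrahedron_vertices {A, B, C, D} = {p + g (vector [0, 0, c]), p + g (vector [0, 0, d]),
      p + g (vector [0, y, c + b * y]), p + g (vector [x, 0, c + a * x])}"
    by (rule tetrahedron_vertices_eq[OF card])
  \<comment> \<open>The columns of \<open>M\<close> are the edge vectors from the vertex at height
    \<open>c\<close>.\<close>
  define M :: "real^3^3" where "M = vector [vector [x, 0, 0], vector [0, y, 0], vector [a * x, b * y, d - c]]"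
  define r where "r = p + g (vector [0, 0, c])"
  have M: "vector [0, 0, c] + M *v axis 1 1 = vector [x, 0, c + a * x]"
    "vector [0, 0, c] + M *v axis 2 1 = vector [0, y, c + b * y]"
    "vector [0, 0, c] + M *v axis 3 1 = vector [0, 0, d]"
    by (simp_all add: M_def vec_eq_iff forall_3 matrix_vector_mult_def sum_3 axis_def)
  have r: "r + g v = p + g (vector [0, 0, c] + v)" for v
    by (simp add: r_def linear_add[OF lin])
  have B: "(Basis :: (real^3) set) = {axis 1 1, axis 2 1, axis 3 1}"
    by (auto simp: Basis_vec_def UNIV_3)
  have "tetrahedron_vertices {A, B, C, D} = (\<lambda>v. r + g (M *v v)) ` insert 0 Basis"
    unfolding vert B r image_insert image_empty M by (simp add: insert_commute)
  then have "tetrahedron_volume {A, B, C, D} = \<bar>det (matrix (\<lambda>v. g (M *v v)))\<bar> / 6"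
    unfolding tetrahedron_volume_def tetrahedron_def
    by (simp only:) (rule measure_simplex_affine_image, intro linear_compose[OF matrix_vector_mul_linear lin, unfolded o_def])
  also have "matrix (\<lambda>v. g (M *v v)) = matrix g ** M"
    using matrix_compose[OF matrix_vector_mul_linear lin, of M] by (simp add: o_def)
  also have "det (matrix g ** M) = det (matrix g) * (x * y * (d - c))"
    by (simp add: det_mul) (simp add: M_def det_3)
  also have "x * y * (d - c) = (d - c) ^ 3 / ((a - a') * (b - b'))"
    by (simp add: x_def y_def power3_eq_cube)
  also have "\<bar>det (matrix g) * ((d - c) ^ 3 / ((a - a') * (b - b')))\<bar> / 6 =
      \<bar>det (matrix g)\<bar> / 6 * \<bar>d - c\<bar> ^ 3 / (\<bar>a' - a\<bar> * \<bar>b' - b\<bar>)"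
    by (simp only: abs_mult abs_divide power_abs abs_minus_commute[of a] abs_minus_commute[of b]) simp
  finally show ?thesis .
qed

lemma det_nonzero: "det (matrix g) \<noteq> 0"
  using bij_is_inj[OF bij] by (simp add: det_nz_iff_inj[OF lin])

end

text \<open>The normals of \<open>A\<close>, \<open>B\<close> and \<open>E\<close> serve as
  coordinate functionals. A vector killed by all three could be added to \<open>p\<close> within the
  intersection, so they form an invertible map, and the chart is its inverse.\<close>

lemma chart_exists:
  assumes "is_plane A" "is_plane B" "is_plane E" and p: "A \<inter> B \<inter> E = {p}"
  obtains g where "chart g p A B"
proof -
  obtain a b e a0 b0 e0 where H: "A = {x. a \<bullet> x = a0}" "B = {x. b \<bullet> x = b0}" "E = {x. e \<bullet> x = e0}"
    using assms is_plane_hyperplane by metis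
  define f :: "real^3 \<Rightarrow> real^3" where "f x = vector [a \<bullet> x, b \<bullet> x, e \<bullet> x]" for x
  have f: "linear f"
    by (rule linearI) (simp_all add: f_def vec_eq_iff forall_3 inner_add_right)
  have "x = 0" if "f x = 0" for x
  proof -
    have "p \<in> A \<inter> B \<inter> E" using p by simp
    moreover have "a \<bullet> x = 0" "b \<bullet> x = 0" "e \<bullet> x = 0"
      using that by (simp_all add: f_def vec_eq_iff forall_3)
    ultimately have "p + x \<in> A \<inter> B \<inter> E" by (simp add: H inner_add_right)
    then show ?thesis using p by simp
  qed
  then have inj: "inj f" using f by (simp add: linear_injective_0)
  then have surj: "surj f" using f by (simp add: linear_injective_imp_surjective)
  have "chart (inv f) p A B"
  proof (rule chart.intro)
    show "linear (inv f)" using f inj surj by (simp add: inj_linear_imp_inv_linear)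
    show "bij (inv f)" using inj surj by (intro bij_imp_bij_inv bijI)
    have "p \<in> A \<inter> B" using p by blast
    then have p: "a \<bullet> p = a0" "b \<bullet> p = b0" by (simp_all add: H)
    show "p + inv f y \<in> A \<longleftrightarrow> y $ 1 = 0" "p + inv f y \<in> B \<longleftrightarrow> y $ 2 = 0" for y
      using surj_f_inv_f[OF surj, of y] p by (auto simp: H inner_add_right f_def vec_eq_iff forall_3)
  qed
  then show ?thesis using that by blast
qed

section \<open>Fourth planes common to three given triples\<close>

lemma card_four_iff:
  "card {a, b, c, d} = 4 \<longleftrightarrow> a \<noteq> b \<and> a \<noteq> c \<and> a \<noteq> d \<and> b \<noteq> c \<and> b \<noteq> d \<and> c \<noteq> d"
  by (auto simp: card_insert_if)

lemma general_position_three: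
  assumes "general_position P" "A \<in> P" "B \<in> P" "C \<in> P" "card {A, B, C} = 3"
  shows "\<exists>x. A \<inter> B \<inter> C = {x}"
proof -
  have "{A, B, C} \<subseteq> P" using assms by simp
  then have "\<exists>x. \<Inter>{A, B, C} = {x}"
    using assms(1,5) unfolding general_position_def by meson
  then show ?thesis by (simp add: Int_assoc)
qed

lemma general_position_four:
  assumes "general_position P" "A \<in> P" "B \<in> P" "C \<in> P" "D \<in> P" "card {A, B, C, D} = 4"
  shows "A \<inter> B \<inter> C \<inter> D = {}"
proof -
  have "{A, B, C, D} \<subseteq> P" using assms by simp
  then have "\<Inter>{A, B, C, D} = {}"
    using assms(1,6) unfolding general_position_def by meson
  then show ?thesis by (simp add: Int_assoc)
qed

text \<open>In a chart for \<open>A\<close> and \<open>B\<close>, a plane \<open>D\<close> is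
  determined by its height and slopes, and the three prescribed volumes become three absolute value
  equations for them.\<close>

lemma card_common_fourth_planes:
  assumes gp: "general_position P" and AB: "A \<in> P" "B \<in> P" and T: "T \<subseteq> P" "card T = 3"
  shows "card {D \<in> P. \<forall>C\<in>T. card {A, B, C, D} = 4 \<and> tetrahedron_volume {A, B, C, D} = v C} \<le> 48"
    (is "card ?N \<le> 48")
proof (cases "?N = {}")
  case False
  \<comment> \<open>The witness \<open>D0\<close> shows that \<open>A\<close>, \<open>B\<close> and
    the planes of \<open>T\<close> are distinct, and later that the prescribed volumes are
    nonzero.\<close>
  then obtain D0 where D0: "D0 \<in> ?N" by blast
  obtain C1 C2 C3 where C: "T = {C1, C2, C3}" "C1 \<noteq> C2" "C1 \<noteq> C3" "C2 \<noteq> C3"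
    using T by (auto simp: card_3_iff)
  have CP: "C1 \<in> P" "C2 \<in> P" "C3 \<in> P" using T C by auto
  have four: "card {A, B, C1, D0} = 4" "card {A, B, C2, D0} = 4" "card {A, B, C3, D0} = 4"
    using D0 C by auto
  have dist: "A \<noteq> B" "C1 \<notin> {A, B}" "C2 \<notin> {A, B}" "C3 \<notin> {A, B}"
    using four unfolding card_four_iff by blast+
  have plane: "is_plane H" if "H \<in> P" for H using gp that by (simp add: general_position_def)
  have three: "\<exists>x. X \<inter> Y \<inter> Z = {x}" if "X \<in> P" "Y \<in> P" "Z \<in> P" "X \<noteq> Y" "X \<noteq> Z" "Y \<noteq> Z" for X Y Z
    using general_position_three[OF gp] that by simp
  obtain p where p: "A \<inter> B \<inter> C1 = {p}" using three AB CP dist by blast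
  obtain g where "chart g p A B" using chart_exists plane AB CP p by metis
  then interpret chart g p A B .
  have "\<exists>s. is_graph H s" if "H \<in> P" "H \<notin> {A, B}" for H
    using that three[of A B H] AB dist(1) is_graph_exists[OF plane] by (metis insertCI)
  then obtain prm where prm: "is_graph H (prm H)" if "H \<in> P" "H \<notin> {A, B}" for H
    by metis
  define K where "K = \<bar>det (matrix g)\<bar> / 6"
  have K: "K > 0" using det_nonzero by (simp add: K_def)
  obtain c1 p1 q1 where 1: "is_graph C1 (c1, p1, q1)" using prm[OF CP(1) dist(2)] by (cases "prm C1") auto
  obtain c2 p2 q2 where 2: "is_graph C2 (c2, p2, q2)" using prm[OF CP(2) dist(3)] by (cases "prm C2") auto
  obtain c3 p3 q3 where 3: "is_graph C3 (c3, p3, q3)" using prm[OF CP(3) dist(4)] by (cases "prm C3") auto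
  have pair: "a \<noteq> a' \<and> b \<noteq> b' \<and> c \<noteq> d"
    if "is_graph X (c, a, b)" "is_graph Y (d, a', b')" "X \<in> P" "Y \<in> P" "X \<noteq> Y" "X \<notin> {A, B}" "Y \<notin> {A, B}"
    for X Y c a b d a' b'
  proof -
    have "\<exists>x. A \<inter> X \<inter> Y = {x}" "\<exists>x. B \<inter> X \<inter> Y = {x}"
      by (rule three; use that AB in auto)+
    then have "b \<noteq> b'" "a \<noteq> a'"
      using two_graphs[OF that(1,2)] by auto
    moreover have "card {A, B, X, Y} = 4" unfolding card_four_iff using that dist(1) by blast
    then have "c \<noteq> d"
      using two_graphs_height[OF that(1,2)] general_position_four[OF gp AB that(3,4)] by blast
    ultimately show ?thesis by blast
  qed
  \<comment> \<open>The volume formula solved for the product of slope differences; general position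
    makes the height and slope differences nonzero, hence \<open>v X\<close> too.\<close>
  have vol: "\<bar>a' - a\<bar> * \<bar>b' - b\<bar> = K / v X * \<bar>d - c\<bar> ^ 3 \<and> v X \<noteq> 0"
    if X: "X \<in> T" "is_graph X (c, a, b)" and D: "D \<in> ?N" "is_graph D (d, a', b')" for X D c a b d a' b'
  proof -
    have X4: "card {A, B, X, D} = 4" using X D by blast
    then have *: "X \<noteq> D" "X \<notin> {A, B}" "D \<notin> {A, B}"
      unfolding card_four_iff by blast+
    have ne: "a \<noteq> a'" "b \<noteq> b'" "c \<noteq> d"
      using pair[OF X(2) D(2) _ _ *] X(1) D(1) T(1) by auto
    define m z where "m = \<bar>a' - a\<bar> * \<bar>b' - b\<bar>" and "z = \<bar>d - c\<bar> ^ 3"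
    have "m \<noteq> 0" "z \<noteq> 0" using ne by (simp_all add: m_def z_def)
    moreover have "v X = K * z / m"
      using tetrahedron_volume_eq[OF X(2) D(2) X4 ne(1,2)] D(1) X(1) by (simp add: K_def m_def z_def)
    ultimately have "v X \<noteq> 0" "m * v X = K * z" using K by simp_all
    then have "m = K / v X * z \<and> v X \<noteq> 0" by (simp add: eq_divide_eq)
    then show ?thesis unfolding m_def z_def .
  qed
  define S where "S = {(d, a, b). \<bar>a - p1\<bar> * \<bar>b - q1\<bar> = K / v C1 * \<bar>d - c1\<bar> ^ 3 \<and>
                    \<bar>a - p2\<bar> * \<bar>b - q2\<bar> = K / v C2 * \<bar>d - c2\<bar> ^ 3 \<and>
                    \<bar>a - p3\<bar> * \<bar>b - q3\<bar> = K / v C3 * \<bar>d - c3\<bar> ^ 3}"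
  have N: "D \<in> P \<and> D \<notin> {A, B}" if "D \<in> ?N" for D
  proof -
    have "C1 \<in> T" by (simp add: C(1))
    then have "card {A, B, C1, D} = 4" using that by blast
    then show ?thesis using that unfolding card_four_iff by blast
  qed
  have CT: "C1 \<in> T" "C2 \<in> T" "C3 \<in> T" by (simp_all add: C(1))
  obtain d0 a0 b0 where "prm D0 = (d0, a0, b0)" by (cases "prm D0")
  then have g0: "is_graph D0 (d0, a0, b0)" using prm N[OF D0] by metis
  have v: "v C1 \<noteq> 0" "v C2 \<noteq> 0" "v C3 \<noteq> 0"
    using vol[OF CT(1) 1 D0 g0] vol[OF CT(2) 2 D0 g0] vol[OF CT(3) 3 D0 g0] by blast+
  have S: "finite S \<and> card S \<le> 48"
    unfolding S_def
    using v pair[OF 1 2 CP(1,2) C(2) dist(2,3)] pair[OF 1 3 CP(1,3) C(3) dist(2,4)]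
      pair[OF 2 3 CP(2,3) C(4) dist(3,4)] K
    by (intro three_abs_equations) simp_all
  have "prm ` ?N \<subseteq> S"
  proof (rule image_subsetI)
    fix D assume D: "D \<in> ?N"
    obtain d a b where s: "prm D = (d, a, b)" by (cases "prm D")
    then have "is_graph D (d, a, b)" using prm N[OF D] by metis
    then show "prm D \<in> S"
      using vol[OF CT(1) 1 D] vol[OF CT(2) 2 D] vol[OF CT(3) 3 D] unfolding S_def s by blast
  qed
  \<comment> \<open>A plane is recovered from its parameters, so counting parameter triples counts
    planes.\<close>
  moreover have "inj_on prm ?N"
  proof (rule inj_onI)
    fix D D' assume D: "D \<in> ?N" "D' \<in> ?N" "prm D = prm D'"
    have "is_graph D (prm D)" "is_graph D' (prm D')" using N[OF D(1)] N[OF D(2)] prm by blast+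
    then show "D = D'" using is_graph_unique D(3) by simp
  qed
  ultimately have "card ?N \<le> card S" using card_inj_on_le S by blast
  then show ?thesis using S by linarith
next
  case True
  show ?thesis unfolding True by simp
qed

section \<open>Counting and deletion\<close>

lemma six_choose_three: "6 * (Suc (Suc m) choose 3) = (m + 2) * (m + 1) * m"
proof (induction m)
  case (Suc m)
  have "Suc (Suc (Suc m)) choose 3 = (Suc (Suc m) choose 2) + (Suc (Suc m) choose 3)"
    by (simp add: numeral_3_eq_3 numeral_2_eq_2)
  moreover have "2 * (Suc (Suc m) choose 2) = (m + 2) * (m + 1)"
    by (simp add: choose_two)
  ultimately show ?case using Suc.IH by (simp add: algebra_simps)
qed (simp add: numeral_3_eq_3)

text \<open>If \<open>j = m - 2\<close> exceeds \<open>l\<close>, then \<open>j * l\<^sup>2\<close>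
  is at most \<open>j ^ 3\<close>, which is at most \<open>m * (m - 1) * (m - 2)\<close>.\<close>

lemma le_truncation_plus_choose_three:
  fixes l :: real
  assumes "l > 0"
  shows "real m \<le> 2 + l + 6 * real (m choose 3) / l\<^sup>2"
proof (cases "real m \<le> 2 + l")
  case False
  then have "2 < real m" using assms by simp
  then have "m = Suc (Suc (m - 2))" by linarith
  then obtain j where m: "m = Suc (Suc j)" by blast
  have j: "real j > l" using False m by simp
  have "6 * real (m choose 3) = real ((j + 2) * (j + 1) * j)"
    unfolding m six_choose_three[symmetric] by simp
  moreover have "j * j * j \<le> (j + 2) * (j + 1) * j" by (intro mult_le_mono) auto
  ultimately have "real j * (real j)\<^sup>2 \<le> 6 * real (m choose 3)"
    by (simp add: power2_eq_square flip: of_nat_mult)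
  moreover have "real j * l\<^sup>2 \<le> real j * (real j)\<^sup>2"
    using j assms by (intro mult_left_mono power_mono) auto
  ultimately have "real j \<le> 6 * real (m choose 3) / l\<^sup>2"
    using assms by (simp add: field_simps)
  then show ?thesis using m assms by simp
qed (simp add: add_increasing2)

text \<open>Kovari--Sos--Turan, with the previous lemma at \<open>l = n powr (2 / 3)\<close> in place of the power mean inequality.\<close>
lemma card_edges_le:
  fixes E :: "('a \<times> 'a) set"
  assumes fin: "finite P" and E: "E \<subseteq> P \<times> P"
    and common: "\<And>T. T \<subseteq> P \<Longrightarrow> card T = 3 \<Longrightarrow> card {y \<in> P. \<forall>x\<in>T. (x, y) \<in> E} \<le> k"
  shows "real (card E) \<le> (real k + 3) * real (card P) powr (5 / 3)"
proof (cases "P = {}")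
  case False
  define n where "n = card P"
  have n: "n \<ge> 1" using False fin by (simp add: n_def Suc_leI card_gt_0_iff)
  define N where "N y = {x \<in> P. (x, y) \<in> E}" for y
  \<comment> \<open>This exponent balances the two main terms \<open>n * l\<close> and
    \<open>n ^ 3 / l\<^sup>2\<close>, both then \<open>n powr (5 / 3)\<close>.\<close>
  define l where "l = real n powr (2 / 3)"
  have l: "l > 0" using n by (simp add: l_def)
  have finN: "finite (N y)" for y using fin by (simp add: N_def)
  have "E = (\<lambda>(y, x). (x, y)) ` Sigma P N"
    using E by (auto simp: N_def image_iff)
  then have "card E = card (Sigma P N)"
    by (simp add: card_image inj_on_def split_def prod_eq_iff)
  then have cardE: "card E = (\<Sum>y\<in>P. card (N y))" using fin finN by simp
  \<comment> \<open>Double counting of pairs of a vertex \<open>y\<close> and a triple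
    \<open>T\<close> inside its neighbourhood.\<close>
  have "(\<Sum>y\<in>P. card (N y) choose 3) = (\<Sum>y\<in>P. card {T \<in> {T. T \<subseteq> P \<and> card T = 3}. \<forall>x\<in>T. (x, y) \<in> E})"
  proof (rule sum.cong[OF refl])
    fix y
    have "{T. T \<subseteq> N y \<and> card T = 3} = {T \<in> {T. T \<subseteq> P \<and> card T = 3}. \<forall>x\<in>T. (x, y) \<in> E}"
      by (auto simp: N_def)
    then show "card (N y) choose 3 = card {T \<in> {T. T \<subseteq> P \<and> card T = 3}. \<forall>x\<in>T. (x, y) \<in> E}"
      using n_subsets[OF finN, of y 3] by simp
  qed
  also have "\<dots> = (\<Sum>T | T \<subseteq> P \<and> card T = 3. card {y \<in> P. \<forall>x\<in>T. (x, y) \<in> E})"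
    using fin by (intro sum_multicount_gen) auto
  also have "\<dots> \<le> (n choose 3) * k"
    using sum_bounded_above[of "{T. T \<subseteq> P \<and> card T = 3}" _ k] common n_subsets[OF fin, of 3]
    by (simp add: n_def)
  finally have "(\<Sum>y\<in>P. card (N y) choose 3) \<le> (n choose 3) * k" .
  then have "(\<Sum>y\<in>P. real (card (N y) choose 3)) \<le> real (n choose 3) * k"
    by (metis of_nat_le_iff of_nat_mult of_nat_sum)
  then have "(\<Sum>y\<in>P. 6 * real (card (N y) choose 3)) \<le> (6 * real (n choose 3)) * k"
    by (simp add: sum_distrib_left[symmetric])
  also have "6 * real (n choose 3) \<le> real n ^ 3"
  proof (cases "n \<ge> 2")
    case True
    then obtain j where j: "n = Suc (Suc j)" by (metis add_2_eq_Suc le_Suc_ex)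
    have "6 * (n choose 3) \<le> n ^ 3"
      unfolding j six_choose_three by (simp add: power3_eq_cube algebra_simps)
    then show ?thesis by (metis of_nat_le_iff of_nat_mult of_nat_numeral of_nat_power)
  qed (use n in \<open>simp add: binomial_eq_0\<close>)
  finally have sum3: "(\<Sum>y\<in>P. 6 * real (card (N y) choose 3)) \<le> real n ^ 3 * k"
    by (simp add: mult_right_mono)
  have "real (card E) = (\<Sum>y\<in>P. real (card (N y)))" by (simp add: cardE)
  also have "\<dots> \<le> (\<Sum>y\<in>P. 2 + l + 6 * real (card (N y) choose 3) / l\<^sup>2)"
    by (intro sum_mono le_truncation_plus_choose_three l)
  also have "\<dots> = n * (2 + l) + (\<Sum>y\<in>P. 6 * real (card (N y) choose 3)) / l\<^sup>2"
    by (simp add: sum.distrib sum_divide_distrib n_def)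
  also have "\<dots> \<le> n * (2 + l) + real n ^ 3 * k / l\<^sup>2"
    using sum3 l by (intro add_left_mono divide_right_mono) auto
  also have "\<dots> = 2 * n + n * l + real k * (real n ^ 3 / l\<^sup>2)"
    by (simp add: algebra_simps)
  also have "n * l = real n powr (5 / 3)"
    using n by (simp add: l_def powr_mult_base)
  also have "l\<^sup>2 = real n powr (4 / 3)"
    by (simp add: l_def power2_eq_square flip: powr_add)
  also have "real n ^ 3 / real n powr (4 / 3) = real n powr (5 / 3)"
    using n by (simp add: powr_diff[symmetric] flip: powr_numeral)
  finally have "real (card E) \<le> 2 * n + real n powr (5 / 3) + real k * real n powr (5 / 3)" .
  moreover have "real n \<le> real n powr (5 / 3)"
    using powr_mono[of 1 "5 / 3" "real n"] n by simp
  ultimately show ?thesis by (simp add: n_def algebra_simps)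
qed (use E in simp)

section \<open>Random index maps and deletion\<close>

lemma card_functions_collision:
  assumes "finite P" "i < s" "j < s" "i \<noteq> j"
  shows "card {h \<in> {..<s} \<rightarrow>\<^sub>E P. h i = h j} * card P \<le> card P ^ s"
proof -
  let ?G = "({..<s} - {j}) \<rightarrow>\<^sub>E P"
  have "card ?G = card P ^ (s - 1)"
    using assms by (simp add: card_PiE)
  \<comment> \<open>The value at \<open>j\<close> is recovered from the value at \<open>i\<close>,
    so the collision costs one free coordinate.\<close>
  have "inj_on (\<lambda>h. restrict h ({..<s} - {j})) {h \<in> {..<s} \<rightarrow>\<^sub>E P. h i = h j}"
  proof (rule inj_onI)
    fix h h' assume h: "h \<in> {h \<in> {..<s} \<rightarrow>\<^sub>E P. h i = h j}" "h' \<in> {h \<in> {..<s} \<rightarrow>\<^sub>E P. h i = h j}"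
      and eq: "restrict h ({..<s} - {j}) = restrict h' ({..<s} - {j})"
    have *: "h x = h' x" if "x \<in> {..<s} - {j}" for x
      using fun_cong[OF eq, of x] that by simp
    have "h j = h' j" using *[of i] h assms by auto
    then show "h = h'"
      using h * by (intro PiE_ext[of h "{..<s}" "\<lambda>_. P" h']) auto
  qed
  moreover have "(\<lambda>h. restrict h ({..<s} - {j})) ` {h \<in> {..<s} \<rightarrow>\<^sub>E P. h i = h j} \<subseteq> ?G"
  proof (rule image_subsetI)
    fix h assume "h \<in> {h \<in> {..<s} \<rightarrow>\<^sub>E P. h i = h j}"
    then have "h \<in> {..<s} \<rightarrow>\<^sub>E P" by blast
    then show "restrict h ({..<s} - {j}) \<in> ?G" by (simp add: PiE_iff)
  qed
  ultimately have "card {h \<in> {..<s} \<rightarrow>\<^sub>E P. h i = h j} \<le> card P ^ (s - 1)"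
    using assms \<open>card ?G = _\<close> by (metis (no_types, lifting) card_inj_on_le finite_Diff finite_PiE finite_lessThan)
  then have "card {h \<in> {..<s} \<rightarrow>\<^sub>E P. h i = h j} * card P \<le> card P ^ (s - 1) * card P"
    by (rule mult_le_mono1)
  also have "\<dots> = card P ^ s"
    using assms power_minus_mult[of s "card P"] by simp
  finally show ?thesis .
qed

text \<open>For \<open>d \<in> J - I\<close> and another \<open>c \<in> J\<close>, once \<open>h\<close> is fixed off \<open>{c, d}\<close> the value \<open>f (h ` I)\<close>
  depends on \<open>h c\<close> alone; this is why \<open>few\<close> lets the prescribed value depend on \<open>C\<close>.\<close>

lemma card_functions_coincidence:
  fixes f :: "'a set \<Rightarrow> real"
  assumes fin: "finite P"
    and few: "\<And>A B v. A \<in> P \<Longrightarrow> B \<in> P \<Longrightarrow>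
      card {(C, D) \<in> P \<times> P. card {A, B, C, D} = 4 \<and> f {A, B, C, D} = v C} \<le> M"
    and I: "I \<subseteq> {..<s}" "card I = 4" and J: "J \<subseteq> {..<s}" "card J = 4" and "I \<noteq> J"
  shows "card {h \<in> {..<s} \<rightarrow>\<^sub>E P. inj_on h J \<and> f (h ` I) = f (h ` J)} * (card P)\<^sup>2 \<le> card P ^ s * M"
proof -
  have finI: "finite I" using I by (simp add: card_ge_0_finite)
  have "\<not> J \<subseteq> I" using card_subset_eq[OF finI] I J \<open>I \<noteq> J\<close> by metis
  then obtain d where d: "d \<in> J" "d \<notin> I" by blast
  then have "card (J - {d}) = 3" using J by simp
  then obtain a b c where abc: "J - {d} = {a, b, c}" "a \<noteq> b" "a \<noteq> c" "b \<noteq> c"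
    by (auto simp: card_3_iff)
  then have Jeq: "J = {a, b, c, d}" "a \<noteq> d" "b \<noteq> d" "c \<noteq> d" using d by auto
  let ?H = "{h \<in> {..<s} \<rightarrow>\<^sub>E P. inj_on h J \<and> f (h ` I) = f (h ` J)}"
  let ?R = "{..<s} - {c, d}"
  let ?G = "?R \<rightarrow>\<^sub>E P"
  \<comment> \<open>The possible values at \<open>c\<close> and \<open>d\<close> once the rest
    \<open>g\<close> of the map is fixed. The prescribed volume depends on \<open>C\<close>, since
    \<open>c\<close> may belong to \<open>I\<close>.\<close>
  define F where "F g = {(C, D) \<in> P \<times> P. card {g a, g b, C, D} = 4 \<and>
      f {g a, g b, C, D} = f ((g(c := C)) ` I)}" for g :: "nat \<Rightarrow> 'a"
  define \<phi> where "\<phi> h = (restrict h ?R, h c, h d)" for h :: "nat \<Rightarrow> 'a"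
  have abR: "a \<in> ?R" "b \<in> ?R" using Jeq J abc by auto
  have cd: "c < s" "d < s" using Jeq J by auto
  have finG: "finite ?G" using fin by (simp add: finite_PiE)
  have "card ?R = s - 2" using cd Jeq by (simp add: card_Diff_subset)
  then have cG: "card ?G = card P ^ (s - 2)" by (simp add: card_PiE)
  have finF: "finite (F g)" for g
    using fin by (auto simp: F_def intro: finite_subset[of _ "P \<times> P"])
  have F: "card (F g) \<le> M" if "g \<in> ?G" for g
    unfolding F_def using that abR by (intro few) auto
  have "inj_on \<phi> ?H"
  proof (rule inj_onI)
    fix h h' assume h: "h \<in> ?H" "h' \<in> ?H" and eq: "\<phi> h = \<phi> h'"
    have *: "h x = h' x" if "x \<in> {..<s}" for x
    proof (cases "x \<in> {c, d}")
      case False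
      moreover have "restrict h ?R x = restrict h' ?R x"
        using eq unfolding \<phi>_def by (metis prod.inject)
      ultimately show ?thesis using that by simp
    qed (use eq in \<open>auto simp: \<phi>_def\<close>)
    then show "h = h'"
      using h by (intro PiE_ext[of h "{..<s}" "\<lambda>_. P" h']) auto
  qed
  moreover have "\<phi> ` ?H \<subseteq> Sigma ?G F"
  proof (rule image_subsetI)
    fix h assume h: "h \<in> ?H"
    define g where "g = restrict h ?R"
    have g: "g a = h a" "g b = h b" using abR by (simp_all add: g_def)
    have hJ: "h ` J = {h a, h b, h c, h d}" using Jeq by simp
    have "card (h ` J) = 4" using h J by (simp add: card_image)
    \<comment> \<open>The restriction \<open>g\<close> is undefined at \<open>c\<close> and
      \<open>d\<close>; the update repairs \<open>c\<close>, and \<open>d\<close> is not in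
      \<open>I\<close>.\<close>
    moreover have "(g(c := h c)) ` I = h ` I"
      using d I by (intro image_cong) (auto simp: g_def)
    moreover have "h c \<in> P" "h d \<in> P" using h cd by auto
    ultimately have "(h c, h d) \<in> F g"
      using h by (simp add: F_def g hJ)
    moreover have "g \<in> ?G" using h by (auto simp: g_def)
    ultimately show "\<phi> h \<in> Sigma ?G F" by (simp add: \<phi>_def g_def)
  qed
  ultimately have "card ?H \<le> card (Sigma ?G F)"
    using finG finF by (metis (no_types, lifting) card_inj_on_le finite_SigmaI)
  also have "\<dots> = (\<Sum>g\<in>?G. card (F g))" using finG finF by simp
  also have "\<dots> \<le> card P ^ (s - 2) * M"
    using sum_bounded_above[of ?G "\<lambda>g. card (F g)" M] F cG by simp
  finally have "card ?H * (card P)\<^sup>2 \<le> card P ^ (s - 2) * M * (card P)\<^sup>2" by (rule mult_le_mono1)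
  also have "\<dots> = card P ^ (s - 2 + 2) * M" by (simp only: power_add mult_ac)
  also have "s - 2 + 2 = s" using cd Jeq by linarith
  finally show ?thesis .
qed

text \<open>Deletion method for a uniformly random map \<open>h\<close> from \<open>s\<close>
  indices to \<open>P\<close>, which need not be injective. The inequality on \<open>s\<close> says
  that at most \<open>s / 2\<close> coincidences and collisions are expected: at most
  \<open>s ^ 8\<close> pairs of quadruples with probability at most \<open>M / n\<^sup>2\<close>
  each, and at most \<open>s\<^sup>2\<close> pairs of indices with probability at most
  \<open>1 / n\<close> each.\<close>

lemma large_subset_inj_on_quadruples:
  fixes f :: "'a set \<Rightarrow> real"
  assumes fin: "finite P" and "P \<noteq> {}"
    and few: "\<And>A B v. A \<in> P \<Longrightarrow> B \<in> P \<Longrightarrow>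
      card {(C, D) \<in> P \<times> P. card {A, B, C, D} = 4 \<and> f {A, B, C, D} = v C} \<le> M"
    and s: "2 * (s ^ 8 * M + s\<^sup>2 * card P) \<le> s * (card P)\<^sup>2"
  obtains S where "S \<subseteq> P" "s \<le> 2 * card S" "inj_on f {Q. Q \<subseteq> S \<and> card Q = 4}"
proof -
  define n where "n = card P"
  have n: "n > 0" using assms by (simp add: n_def card_gt_0_iff)
  let ?F = "{..<s} \<rightarrow>\<^sub>E P"
  define W where "W = {(I, J). I \<subseteq> {..<s} \<and> card I = 4 \<and> J \<subseteq> {..<s} \<and> card J = 4 \<and> I \<noteq> J}"
  define V where "V = {(i, j). i < j \<and> j < s}"
  define Bad where "Bad h = {x \<in> W. inj_on h (snd x) \<and> f (h ` fst x) = f (h ` snd x)}" for h :: "nat \<Rightarrow> 'a"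
  define Col where "Col h = {x \<in> V. h (fst x) = h (snd x)}" for h :: "nat \<Rightarrow> 'a"
  let ?K = "{I. I \<subseteq> {..<s} \<and> card I = 4}"
  have "card ?K = s choose 4" using n_subsets[of "{..<s}" 4] by simp
  moreover have "s choose 4 \<le> s ^ 4"
    using binomial_le_pow[of 4 s] by (cases "4 \<le> s") (simp_all add: binomial_eq_0)
  ultimately have K: "finite ?K" "card ?K \<le> s ^ 4" by (simp, metis)
  have W: "finite W" "card W \<le> s ^ 8"
  proof -
    have sub: "W \<subseteq> ?K \<times> ?K" by (auto simp: W_def)
    then show "finite W" using K(1) by (meson finite_SigmaI finite_subset)
    have "card W \<le> card ?K * card ?K"
      using card_mono[OF _ sub] K(1) by (simp add: card_cartesian_product)
    also have "\<dots> \<le> s ^ 4 * s ^ 4" using K(2) by (rule mult_le_mono) (rule K(2))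
    finally show "card W \<le> s ^ 8" by (simp flip: power_add)
  qed
  have V: "finite V" "card V \<le> s\<^sup>2"
  proof -
    have sub: "V \<subseteq> {..<s} \<times> {..<s}" by (auto simp: V_def)
    then show "finite V" by (rule finite_subset) simp
    show "card V \<le> s\<^sup>2" using card_mono[OF _ sub] by (simp add: power2_eq_square)
  qed
  have F: "finite ?F" "card ?F = n ^ s" using fin by (simp_all add: finite_PiE card_PiE n_def)
  have sumBad: "(\<Sum>h\<in>?F. card (Bad h)) * n\<^sup>2 \<le> s ^ 8 * M * n ^ s"
  proof -
    have "(\<Sum>h\<in>?F. card (Bad h)) = (\<Sum>x\<in>W. card {h \<in> ?F. inj_on h (snd x) \<and> f (h ` fst x) = f (h ` snd x)})"
      unfolding Bad_def using F W by (intro sum_multicount_gen) auto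
    then have "(\<Sum>h\<in>?F. card (Bad h)) * n\<^sup>2 =
        (\<Sum>x\<in>W. card {h \<in> ?F. inj_on h (snd x) \<and> f (h ` fst x) = f (h ` snd x)} * n\<^sup>2)"
      by (simp add: sum_distrib_right)
    also have "\<dots> \<le> card W * (n ^ s * M)"
      unfolding n_def
      using sum_bounded_above[of W _ "card P ^ s * M"] card_functions_coincidence[OF fin few]
      by (auto simp: W_def)
    also have "\<dots> \<le> s ^ 8 * (n ^ s * M)" using W by (intro mult_le_mono1)
    finally show ?thesis by (simp add: mult_ac)
  qed
  have sumCol: "(\<Sum>h\<in>?F. card (Col h)) * n \<le> s\<^sup>2 * n ^ s"
  proof -
    have "(\<Sum>h\<in>?F. card (Col h)) = (\<Sum>x\<in>V. card {h \<in> ?F. h (fst x) = h (snd x)})"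
      unfolding Col_def using F V by (intro sum_multicount_gen) auto
    then have "(\<Sum>h\<in>?F. card (Col h)) * n = (\<Sum>x\<in>V. card {h \<in> ?F. h (fst x) = h (snd x)} * n)"
      by (simp add: sum_distrib_right)
    also have "\<dots> \<le> card V * n ^ s"
      unfolding n_def
      using sum_bounded_above[of V _ "card P ^ s"] card_functions_collision[OF fin]
      by (auto simp: V_def)
    also have "\<dots> \<le> s\<^sup>2 * n ^ s" using V by (intro mult_le_mono1)
    finally show ?thesis .
  qed
  \<comment> \<open>Averaging over all maps. Over the integers the negation yields
    \<open>s + 1\<close>, which makes the contradiction strict.\<close>
  have "\<exists>h\<in>?F. 2 * (card (Bad h) + card (Col h)) \<le> s"
  proof (rule ccontr)
    assume "\<not> ?thesis"
    then have "s + 1 \<le> 2 * (card (Bad h) + card (Col h))" if "h \<in> ?F" for h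
      using that by force
    then have "(\<Sum>h\<in>?F. s + 1) \<le> (\<Sum>h\<in>?F. 2 * (card (Bad h) + card (Col h)))"
      by (rule sum_mono)
    then have "n ^ s * (s + 1) \<le> 2 * ((\<Sum>h\<in>?F. card (Bad h)) + (\<Sum>h\<in>?F. card (Col h)))"
      using F by (simp add: sum.distrib sum_distrib_left[symmetric])
    then have "n ^ s * (s + 1) * n\<^sup>2 \<le> 2 * ((\<Sum>h\<in>?F. card (Bad h)) + (\<Sum>h\<in>?F. card (Col h))) * n\<^sup>2"
      by (rule mult_le_mono1)
    also have "\<dots> = 2 * ((\<Sum>h\<in>?F. card (Bad h)) * n\<^sup>2 + (\<Sum>h\<in>?F. card (Col h)) * n * n)"
      by (simp add: algebra_simps power2_eq_square)
    also have "\<dots> \<le> 2 * (s ^ 8 * M * n ^ s + s\<^sup>2 * n ^ s * n)"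
      using sumBad sumCol by (intro mult_le_mono2 add_le_mono mult_le_mono1)
    also have "\<dots> = n ^ s * (2 * (s ^ 8 * M + s\<^sup>2 * n))" by (simp add: algebra_simps)
    also have "\<dots> \<le> n ^ s * (s * n\<^sup>2)" using s by (intro mult_le_mono2) (simp add: n_def)
    finally show False using n by simp
  qed
  then obtain h where h: "h \<in> ?F" "2 * (card (Bad h) + card (Col h)) \<le> s" by blast
  \<comment> \<open>One index of the first quadruple is deleted for every coincidence, and the
    smaller index for every collision.\<close>
  define e where "e x = (SOME i. i \<in> fst x)" for x :: "nat set \<times> nat set"
  have e: "e (I, J) \<in> I" if "card I = 4" for I J
    using that some_in_eq[of I] by (auto simp: e_def)
  define R where "R = {..<s} - (e ` Bad h \<union> fst ` Col h)"
  have "finite (Bad h)" "finite (Col h)" using W V by (auto simp: Bad_def Col_def)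
  then have "card (e ` Bad h \<union> fst ` Col h) \<le> card (Bad h) + card (Col h)" "finite (e ` Bad h \<union> fst ` Col h)"
    using card_Un_le card_image_le by (meson add_mono le_trans, blast)
  then have R: "s \<le> 2 * card R"
    using diff_card_le_card_Diff[of "e ` Bad h \<union> fst ` Col h" "{..<s}"] h(2) by (simp add: R_def)
  have inj: "inj_on h R"
  proof (rule linorder_inj_onI')
    fix i j assume ij: "i \<in> R" "j \<in> R" "i < j"
    show "h i \<noteq> h j"
    proof
      assume "h i = h j"
      then have "(i, j) \<in> Col h" using ij by (auto simp: Col_def V_def R_def)
      then show False using ij by (force simp: R_def)
    qed
  qed
  show ?thesis
  proof
    show "h ` R \<subseteq> P" using h(1) by (auto simp: R_def)
    show "s \<le> 2 * card (h ` R)" using R by (simp add: card_image inj)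
    show "inj_on f {Q. Q \<subseteq> h ` R \<and> card Q = 4}"
    proof (rule inj_onI, rule ccontr)
      fix Q Q' assume Q: "Q \<in> {Q. Q \<subseteq> h ` R \<and> card Q = 4}" "Q' \<in> {Q. Q \<subseteq> h ` R \<and> card Q = 4}"
        and eq: "f Q = f Q'" "Q \<noteq> Q'"
      from Q obtain I J where IJ: "I \<subseteq> R" "Q = h ` I" "J \<subseteq> R" "Q' = h ` J"
        by (auto simp: subset_image_iff)
      have inj': "inj_on h I" "inj_on h J" using inj IJ by (auto intro: inj_on_subset)
      have c: "card I = 4" "card J = 4" using Q IJ inj' by (auto simp: card_image)
      have "(I, J) \<in> Bad h"
        using IJ c eq inj' by (auto simp: Bad_def W_def R_def)
      then have "e (I, J) \<notin> R" by (auto simp: R_def)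
      then show False using e[OF c(1)] IJ by blast
    qed
  qed
qed

text \<open>Three planes \<open>C\<close> have at most 48 common partners \<open>D\<close>, so the
  edge bound applies with constant \<open>48 + 3\<close>.\<close>

lemma card_equal_volumes_le:
  assumes gp: "general_position P" and AB: "A \<in> P" "B \<in> P"
  shows "real (card {(C, D) \<in> P \<times> P. card {A, B, C, D} = 4 \<and> tetrahedron_volume {A, B, C, D} = v C})
    \<le> 51 * real (card P) powr (5 / 3)"
proof -
  let ?E = "{(C, D) \<in> P \<times> P. card {A, B, C, D} = 4 \<and> tetrahedron_volume {A, B, C, D} = v C}"
  have fin: "finite P" using gp by (simp add: general_position_def)
  have "card {D \<in> P. \<forall>C\<in>T. (C, D) \<in> ?E} \<le> 48" if "T \<subseteq> P" "card T = 3" for T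
  proof -
    have "{D \<in> P. \<forall>C\<in>T. (C, D) \<in> ?E} =
        {D \<in> P. \<forall>C\<in>T. card {A, B, C, D} = 4 \<and> tetrahedron_volume {A, B, C, D} = v C}"
      using that(1) by blast
    then show ?thesis using card_common_fourth_planes[OF gp AB that] by simp
  qed
  then show ?thesis
    using card_edges_le[OF fin, of ?E 48] by auto
qed

section \<open>Planes in general position\<close>

text \<open>A point lies on the plane with index \<open>i\<close> iff \<open>i\<close> is a root of
  the monic cubic \<open>T^3 - x3 * T^2 - x2 * T - x1\<close>. Three roots determine such a cubic
  and no four are possible, so these planes are in general position.\<close>

definition moment_plane :: "nat \<Rightarrow> (real^3) set" where
  "moment_plane i = {x. x $ 1 + x $ 2 * real i + x $ 3 * (real i)\<^sup>2 = real i ^ 3}"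

lemma inj_moment_plane: "inj moment_plane"
proof (rule injI)
  fix i j assume eq: "moment_plane i = moment_plane j"
  have "(vector [real i ^ 3, 0, 0] :: real^3) \<in> moment_plane i" by (simp add: moment_plane_def)
  then have "real i ^ 3 = real j ^ 3" unfolding eq by (simp add: moment_plane_def)
  then have "real i = real j" by (rule power_eq_imp_eq_base) simp_all
  then show "i = j" by simp
qed

lemma is_plane_moment_plane: "is_plane (moment_plane i)"
proof -
  have eq: "moment_plane i = {x. vector [1, real i, (real i)\<^sup>2] \<bullet> x = real i ^ 3}"
    by (simp add: moment_plane_def inner_vec_def sum_3 mult.commute)
  have "(vector [1, real i, (real i)\<^sup>2] :: real^3) \<noteq> 0"
    by (simp add: vec_eq_iff forall_3)
  then have "aff_dim (moment_plane i) = int (DIM(real^3) - 1)"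
    unfolding eq by (rule aff_dim_hyperplane)
  then show ?thesis unfolding is_plane_def eq by (simp add: affine_hyperplane)
qed

text \<open>Vieta's formulas for the cubic with roots \<open>i\<close>, \<open>j\<close>,
  \<open>k\<close>, with signs as in the plane equation.\<close>

lemma moment_planes_three:
  assumes "i \<noteq> j" "i \<noteq> k" "j \<noteq> k"
  shows "moment_plane i \<inter> moment_plane j \<inter> moment_plane k =
    {vector [real i * real j * real k, - (real i * real j + real i * real k + real j * real k), real i + real j + real k]}"
proof -
  define r s t where "r = real i" and "s = real j" and "t = real k"
  have ne: "r \<noteq> s" "r \<noteq> t" "s \<noteq> t" using assms by (simp_all add: r_def s_def t_def)
  have "a + b * r + c * r\<^sup>2 = r ^ 3 \<and> a + b * s + c * s\<^sup>2 = s ^ 3 \<and> a + b * t + c * t\<^sup>2 = t ^ 3 \<longleftrightarrow>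
      a = r * s * t \<and> b = - (r * s + r * t + s * t) \<and> c = r + s + t" (is "?L \<longleftrightarrow> ?R") for a b c :: real
  proof
    assume L: ?L
    then have "(r - s) * (b + c * (r + s) - (r\<^sup>2 + r * s + s\<^sup>2)) = 0"
      "(r - t) * (b + c * (r + t) - (r\<^sup>2 + r * t + t\<^sup>2)) = 0" by algebra+
    then have b: "b + c * (r + s) - (r\<^sup>2 + r * s + s\<^sup>2) = 0" "b + c * (r + t) - (r\<^sup>2 + r * t + t\<^sup>2) = 0"
      using ne by simp_all
    then have "(s - t) * (c - (r + s + t)) = 0" by algebra
    then have c: "c = r + s + t" using ne by simp
    then have "b = - (r * s + r * t + s * t)" using b(1) by algebra
    then show ?R using c L by algebra
  next
    assume ?R
    then show ?L by algebra
  qed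
  note key = this[unfolded r_def s_def t_def]
  show ?thesis
  proof (rule set_eqI)
    fix x :: "real^3"
    show "x \<in> moment_plane i \<inter> moment_plane j \<inter> moment_plane k \<longleftrightarrow> x \<in> {vector [real i * real j * real k,
        - (real i * real j + real i * real k + real j * real k), real i + real j + real k]}"
      using key[of "x $ 1" "x $ 2" "x $ 3"]
      by (simp only: moment_plane_def Int_iff mem_Collect_eq singleton_iff vec_eq_iff forall_3 vector_3 conj_assoc)
  qed
qed

lemma general_position_moment_planes:
  assumes "4 \<le> n"
  shows "general_position (moment_plane ` {..<n})" and "card (moment_plane ` {..<n}) = n"
proof -
  note inj = inj_on_subset[OF inj_moment_plane subset_UNIV]
  show card: "card (moment_plane ` {..<n}) = n" by (simp add: card_image inj)
  have three: "\<exists>x. \<Inter>T = {x}" if T: "T \<subseteq> moment_plane ` {..<n}" "card T = 3" for T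
  proof -
    obtain I where I: "T = moment_plane ` I" using T(1) by (auto simp: subset_image_iff)
    then have "card I = 3" using T(2) by (simp add: card_image inj)
    then obtain i j k where "I = {i, j, k}" "i \<noteq> j" "i \<noteq> k" "j \<noteq> k" by (auto simp: card_3_iff)
    then show ?thesis using moment_planes_three[of i j k] by (simp add: I Int_assoc)
  qed
  have four: "\<Inter>T = {}" if T: "T \<subseteq> moment_plane ` {..<n}" "card T = 4" for T
  proof -
    obtain I where I: "T = moment_plane ` I" using T(1) by (auto simp: subset_image_iff)
    then have cI: "card I = Suc 3" using T(2) by (simp add: card_image inj)
    then obtain l I' where I': "I = insert l I'" "l \<notin> I'" "card I' = 3" unfolding card_Suc_eq by blast
    then obtain i j k where ijk: "I' = {i, j, k}" "i \<noteq> j" "i \<noteq> k" "j \<noteq> k" by (auto simp: card_3_iff)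
    have l: "l \<noteq> i" "l \<noteq> j" "l \<noteq> k" using I' ijk by auto
    let ?r = "real i" and ?s = "real j" and ?t = "real k" and ?u = "real l"
    let ?x = "vector [?r * ?s * ?t, - (?r * ?s + ?r * ?t + ?s * ?t), ?r + ?s + ?t] :: real^3"
    have "?x \<notin> moment_plane l"
    proof
      assume "?x \<in> moment_plane l"
      then have "?r * ?s * ?t + - (?r * ?s + ?r * ?t + ?s * ?t) * ?u + (?r + ?s + ?t) * ?u\<^sup>2 = ?u ^ 3"
        by (simp only: moment_plane_def mem_Collect_eq vector_3)
      \<comment> \<open>Membership says that the cubic with roots \<open>i\<close>,
        \<open>j\<close>, \<open>k\<close> also vanishes at \<open>l\<close>.\<close>
      then have "(?u - ?r) * (?u - ?s) * (?u - ?t) = 0" by algebra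
      then show False using l by simp
    qed
    moreover have "\<Inter>T = moment_plane l \<inter> (moment_plane i \<inter> moment_plane j \<inter> moment_plane k)"
      by (simp add: I I' ijk Int_assoc)
    ultimately show ?thesis using moment_planes_three[OF ijk(2-4)] by simp
  qed
  show "general_position (moment_plane ` {..<n})"
    unfolding general_position_def using assms card three four by (simp add: is_plane_moment_plane)
qed

section \<open>The lower bound for \<open>D3\<close>\<close>

lemma D3_ge:
  assumes "4 \<le> n"
    and "\<And>P. general_position P \<Longrightarrow> card P = n \<Longrightarrow> \<exists>S. S \<subseteq> P \<and> t \<le> card S \<and> distinct_volumes S"
  shows "t \<le> D3 n"
  unfolding D3_def
proof (rule Greatest_le_nat)
  show "\<forall>P. general_position P \<and> card P = n \<longrightarrow> (\<exists>S. S \<subseteq> P \<and> card S = t \<and> distinct_volumes S)"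
  proof (intro allI impI)
    fix P assume "general_position P \<and> card P = n"
    then obtain S where S: "S \<subseteq> P" "t \<le> card S" "distinct_volumes S" using assms(2) by blast
    obtain S' where S': "S' \<subseteq> S" "card S' = t" using obtain_subset_with_card_n[OF S(2)] by metis
    then have "distinct_volumes S'"
      using S(3) unfolding distinct_volumes_def by (auto intro: inj_on_subset)
    then show "\<exists>S. S \<subseteq> P \<and> card S = t \<and> distinct_volumes S" using S S' by blast
  qed
  \<comment> \<open>The greatest admissible value is meaningful only if admissible values are
    bounded; the moment planes supply one family of size \<open>n\<close> in general position, which
    bounds them by \<open>n\<close>.\<close>
  show "u \<le> n"
    if "\<forall>P. general_position P \<and> card P = n \<longrightarrow> (\<exists>S. S \<subseteq> P \<and> card S = u \<and> distinct_volumes S)" for u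
  proof -
    note gpm = general_position_moment_planes[OF assms(1)]
    from that[rule_format, OF conjI[OF gpm]] obtain S where "S \<subseteq> moment_plane ` {..<n}" "card S = u"
      by blast
    then show ?thesis using card_mono[of "moment_plane ` {..<n}" S] gpm(2) by simp
  qed
qed

theorem theorem4:
  "\<exists>c::real. c > 0 \<and> (\<exists>N::nat. \<forall>n\<ge>N. real (D3 n) \<ge> c * real n powr (1 / 21))"
proof (intro exI conjI allI impI)
  \<comment> \<open>Since \<open>n powr (1 / 21)\<close> will be at least 6, its third minus 1 is at
    least its sixth; this bounds \<open>s\<close> from below, and half of \<open>s\<close>
    survives.\<close>
  show "(1 / 12 :: real) > 0" by simp
  fix n :: nat assume n: "n \<ge> 6 ^ 21"
  have n1: "n \<ge> 4" by (rule order.trans[OF _ n]) simp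
  \<comment> \<open>The divisor 3 suffices because \<open>3 ^ 7 = 2187\<close> exceeds
    \<open>204 = 4 * 51\<close>: 51 comes from the bound on equal volumes, and 4 makes each of the
    two terms of the deletion condition at most half of the total.\<close>
  define s where "s = nat \<lfloor>real n powr (1 / 21) / 3\<rfloor>"
  define M where "M = nat \<lfloor>51 * real n powr (5 / 3)\<rfloor>"
  have "(6 :: real) = (6 powr 21) powr (1 / 21)"
    by (simp only: powr_powr) simp
  also have "\<dots> \<le> real n powr (1 / 21)"
    using n by (intro powr_mono2) simp_all
  finally have big: "6 \<le> real n powr (1 / 21)" .
  have s_le: "real s \<le> real n powr (1 / 21) / 3" and s_ge: "real n powr (1 / 21) / 3 - 1 \<le> real s"
  proof -
    have "real s = of_int \<lfloor>real n powr (1 / 21) / 3\<rfloor>" unfolding s_def by simp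
    then show "real s \<le> real n powr (1 / 21) / 3" "real n powr (1 / 21) / 3 - 1 \<le> real s"
      by linarith+
  qed
  have s1: "1 \<le> s" using s_ge big by linarith
  have "real s ^ 7 \<le> (real n powr (1 / 21) / 3) ^ 7"
    using s_le by (intro power_mono) auto
  also have "\<dots> = real n powr (1 / 3) / 2187"
    using n1 by (simp add: power_divide powr_powr flip: powr_realpow)
  finally have "real s ^ 7 \<le> real n powr (1 / 3) / 2187" .
  moreover have "0 \<le> real s ^ 7" by simp
  ultimately have s7: "204 * real s ^ 7 \<le> real n powr (1 / 3)" by linarith
  have M: "real M \<le> 51 * real n powr (5 / 3)" unfolding M_def by simp
  have "204 * (real s ^ 8 * real M) \<le> 204 * (real s ^ 8 * (51 * real n powr (5 / 3)))"
    using M by (intro mult_left_mono) auto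
  also have "\<dots> = 51 * (real s * (204 * real s ^ 7) * real n powr (5 / 3))"
    by (simp add: power_numeral_reduce)
  also have "\<dots> \<le> 51 * (real s * real n powr (1 / 3) * real n powr (5 / 3))"
    using s7 by (intro mult_left_mono mult_right_mono) auto
  also have "\<dots> = 51 * (real s * (real n)\<^sup>2)"
    using n1 by (simp add: mult.assoc flip: powr_add powr_numeral)
  finally have t1: "4 * (real s ^ 8 * real M) \<le> real s * (real n)\<^sup>2" by linarith
  \<comment> \<open>The collision term only needs \<open>4 * s\<close> to be at most
    \<open>n\<close>, which follows from the same bound on \<open>s ^ 7\<close>.\<close>
  have "real s \<le> real s ^ 7" using self_le_power[of "real s" 7] s1 by simp
  then have "4 * real s \<le> 204 * real s ^ 7" by linarith
  also have "\<dots> \<le> real n powr 1"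
    using s7 powr_mono[of "1 / 3" 1 "real n"] n1 by simp
  finally have "4 * real s \<le> real n" by simp
  then have "(4 * real s) * (real s * real n) \<le> real n * (real s * real n)"
    by (intro mult_right_mono) auto
  then have t2: "4 * ((real s)\<^sup>2 * real n) \<le> real s * (real n)\<^sup>2"
    by (simp add: power2_eq_square mult_ac)
  have "real (2 * (s ^ 8 * M + s\<^sup>2 * n)) \<le> real (s * n\<^sup>2)"
    using t1 t2 by simp
  then have ineq: "2 * (s ^ 8 * M + s\<^sup>2 * n) \<le> s * n\<^sup>2" by (simp only: of_nat_le_iff)
  \<comment> \<open>Rounding up is allowed because \<open>card S\<close> is an integer with
    \<open>s \<le> 2 * card S\<close>.\<close>
  have "(s + 1) div 2 \<le> D3 n"
  proof (rule D3_ge[OF n1])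
    fix P assume gp: "general_position P" and P: "card P = n"
    have fin: "finite P" "P \<noteq> {}" using gp by (auto simp: general_position_def)
    have "card {(C, D) \<in> P \<times> P. card {A, B, C, D} = 4 \<and> tetrahedron_volume {A, B, C, D} = v C} \<le> M"
      if "A \<in> P" "B \<in> P" for A B v
      using card_equal_volumes_le[OF gp that, of v] unfolding M_def P by (simp add: le_nat_floor)
    from large_subset_inj_on_quadruples[OF fin this ineq[folded P]]
    obtain S where "S \<subseteq> P" "s \<le> 2 * card S" "inj_on tetrahedron_volume {Q. Q \<subseteq> S \<and> card Q = 4}"
      by blast
    then show "\<exists>S. S \<subseteq> P \<and> (s + 1) div 2 \<le> card S \<and> distinct_volumes S"
      unfolding distinct_volumes_def by (intro exI[of _ S]) auto
  qed
  then have "real s \<le> 2 * real (D3 n)" by linarith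
  then show "1 / 12 * real n powr (1 / 21) \<le> real (D3 n)"
    using s_ge big by simp
qed

end
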